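(* Let $G$ be a Fréchet space and let $A=(a_{i,k})_{i,k\in\mathbb{N}}$, $C=(c_{j,k})_{j,k\in\mathbb{N}}$ be Köthe matrices. Then $(\lambda(A),G,\lambda^\infty(C))\in\mathfrak{TF}$ if and only if there exists a nondecreasing function $S:\mathbb{N}\to\mathbb{N}$ such that for every nondecreasing $\phi:\mathbb{N}\to\mathbb{N}$ the following holds: there exists $k_0\in\mathbb{N}$ such that for every $k\ge k_0$ there exist $q_k\in\mathbb{N}$ and $C_k>0$ with $$\frac{c_{j,k}}{a_{i,S(k)}}\,|y'(y)|\le C_k\max_{1\le q\le q_k}\Bigl\{\frac{\|y\|_q}{a_{i,\phi(q)}}\Bigr\}\max_{1\le q\le q_k}\Bigl\{\|y'\|^*_{\phi(q)}\,c_{j,q}\Bigr\}$$ for every $y\in G$, $y'\in G'$ and $i,j\in\mathbb{N}$.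
   Context: $\mathbb{N}=\{1,2,3,\dots\}$. Every Fréchet space is equipped with a fixed grading, i.e. an increasing sequence of seminorms $(\|\cdot\|_k)_{k\in\mathbb{N}}$ defining its topology. $G'$ is the topological dual, and $\|y'\|^*_k=\sup_{\|x\|_k\le1}|y'(x)|\in[0,\infty]$ for $y'\in G'$. A Köthe matrix is a matrix $(a_{n,k})_{n,k\in\mathbb{N}}$ of non-negative scalars with $a_{n,k}\le a_{n,k+1}$ for all $n,k$, such that for every $n$ there is $k$ with $a_{n,k}>0$. With $\mathbb{K}=\mathbb{R}$ or $\mathbb{C}$: $\lambda(A)=\{x\in\mathbb{K}^{\mathbb{N}}:\|x\|_k=\sum_j|x_j|a_{j,k}<\infty\ \forall k\}$ and $\lambda^\infty(A)=\{x\in\mathbb{K}^{\mathbb{N}}:\|x\|_k=\sup_j|x_j|a_{j,k}<\infty\ \forall k\}$, each graded by the indicated seminorms. $L(E,F)$ is the space of continuous linear operators $E\to F$. For $T\in L(E,F)$ put $\|T\|_{k,r}=\sup_{\|x\|_r\le1}\|Tx\|_k\in[0,\infty]$ and $\pi_T(k)=\inf\{r\in\mathbb{N}:\|T\|_{k,r}<\infty\}$. $L^G(E,F)$ is the set of $T\in L(E,F)$ of the form $T=RQ$ with $Q\in L(E,G)$, $R\in L(G,F)$. $(E,G,F)\in\mathfrak{TF}$ (tame factorization property) means: there is a nondecreasing $S:\mathbb{N}\to\mathbb{N}$ such that for every $T\in L^G(E,F)$ there is $k_0$ with $\pi_T(k)\le S(k)$ for all $k\ge k_0$. Conventions: quantities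 are computed in $[0,\infty]$ with $1/0=\infty$ and, inside a single term, $0\cdot\infty=0$ (so $0/0=0$); a product of two maxima is $\infty$ as soon as one of the maxima is $\infty$. *)

theory Defs
  imports "HOL-Analysis.Analysis" "HOL-Library.Function_Algebras"
begin

text \<open>
  The scalar field is a type \<open>'k\<close> of class \<open>{real_normed_field, banach}\<close>. The types \<open>real\<close> and
  \<open>complex\<close> are instances, and by the Gelfand--Mazur theorem these are, up to isometric isomorphism,
  the only ones.

  The index set of gradings, matrices and sequences is \<open>nat\<close>, so indices start at 0 instead of 1;
  only the order of the index set is ever used.
\<close>

section \<open>Graded Frechet spaces\<close>

record ('k, 'v) graded_space =
  points :: "'v set"
  scale :: "'k \<Rightarrow> 'v \<Rightarrow> 'v"
  seminorm :: "nat \<Rightarrow> 'v \<Rightarrow> real"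

definition graded_topology :: "('k, 'v::ab_group_add) graded_space \<Rightarrow> 'v topology" where
  "graded_topology E = topology_generated_by
     {{y \<in> points E. seminorm E k (y - x) < e} | x k e. x \<in> points E \<and> 0 < e}"

definition is_seminorm_on ::
  "'v set \<Rightarrow> ('k::real_normed_field \<Rightarrow> 'v \<Rightarrow> 'v) \<Rightarrow> ('v::ab_group_add \<Rightarrow> real) \<Rightarrow> bool" where
  "is_seminorm_on V s p \<longleftrightarrow>
     (\<forall>x\<in>V. 0 \<le> p x) \<and>
     (\<forall>x\<in>V. \<forall>y\<in>V. p (x + y) \<le> p x + p y) \<and>
     (\<forall>c. \<forall>x\<in>V. p (s c x) = norm c * p x)"

text \<open>
  The last two clauses say that the topology is Hausdorff and complete; as it is metrizable,
  it suffices to consider Cauchy sequences.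
\<close>

definition graded_frechet_space ::
  "('k::real_normed_field, 'v::ab_group_add) graded_space \<Rightarrow> bool" where
  "graded_frechet_space E \<longleftrightarrow>
     (vector_space (scale E) \<and> module.subspace (scale E) (points E)) \<and>
     (\<forall>k. is_seminorm_on (points E) (scale E) (seminorm E k) \<and>
          (\<forall>x\<in>points E. seminorm E k x \<le> seminorm E (Suc k) x)) \<and>
     (\<forall>x\<in>points E. (\<forall>k. seminorm E k x = 0) \<longrightarrow> x = 0) \<and>
     (\<forall>X. (\<forall>n. X n \<in> points E) \<longrightarrow>
          (\<forall>k. \<forall>e>0. \<exists>N. \<forall>m\<ge>N. \<forall>n\<ge>N. seminorm E k (X m - X n) < e) \<longrightarrow>
          (\<exists>l. limitin (graded_topology E) X l sequentially))"

section \<open>Operators and functionals\<close>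

definition linear_on ::
  "'v set \<Rightarrow> ('k \<Rightarrow> 'v \<Rightarrow> 'v) \<Rightarrow> ('k \<Rightarrow> 'w \<Rightarrow> 'w) \<Rightarrow> ('v::ab_group_add \<Rightarrow> 'w::ab_group_add) \<Rightarrow> bool" where
  "linear_on V s t f \<longleftrightarrow>
     (\<forall>x\<in>V. \<forall>y\<in>V. f (x + y) = f x + f y) \<and> (\<forall>c. \<forall>x\<in>V. f (s c x) = t c (f x))"

text \<open>
  Operators are total functions of which only the values on \<open>points E\<close> matter; \<^const>\<open>continuous_map\<close>
  includes that \<open>points E\<close> is mapped into \<open>points F\<close>.
\<close>

definition operators ::
  "('k, 'v::ab_group_add) graded_space \<Rightarrow> ('k, 'w::ab_group_add) graded_space \<Rightarrow> ('v \<Rightarrow> 'w) set" where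
  "operators E F = {T. linear_on (points E) (scale E) (scale F) T \<and>
                       continuous_map (graded_topology E) (graded_topology F) T}"

definition dual :: "('k::real_normed_field, 'v::ab_group_add) graded_space \<Rightarrow> ('v \<Rightarrow> 'k) set" where
  "dual E = {f. linear_on (points E) (scale E) (*) f \<and> continuous_map (graded_topology E) euclidean f}"

definition dual_norm ::
  "('k::real_normed_field, 'v) graded_space \<Rightarrow> nat \<Rightarrow> ('v \<Rightarrow> 'k) \<Rightarrow> ennreal" where
  "dual_norm E k f = (SUP x\<in>{x \<in> points E. seminorm E k x \<le> 1}. ennreal (norm (f x)))"

definition operator_norm ::
  "('k, 'v) graded_space \<Rightarrow> ('k, 'w) graded_space \<Rightarrow> nat \<Rightarrow> nat \<Rightarrow> ('v \<Rightarrow> 'w) \<Rightarrow> ennreal" where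
  "operator_norm E F k r T =
     (SUP x\<in>{x \<in> points E. seminorm E r x \<le> 1}. ennreal (seminorm F k (T x)))"

definition continuity_index ::
  "('k, 'v) graded_space \<Rightarrow> ('k, 'w) graded_space \<Rightarrow> ('v \<Rightarrow> 'w) \<Rightarrow> nat \<Rightarrow> enat" where
  "continuity_index E F T k = (INF r\<in>{r. operator_norm E F k r T < \<infinity>}. enat r)"

definition factorable_operators ::
  "('k, 'v::ab_group_add) graded_space \<Rightarrow> ('k, 'u::ab_group_add) graded_space \<Rightarrow>
   ('k, 'w::ab_group_add) graded_space \<Rightarrow> ('v \<Rightarrow> 'w) set" where
  "factorable_operators E G F = {T \<in> operators E F.
     \<exists>Q\<in>operators E G. \<exists>R\<in>operators G F. \<forall>x\<in>points E. T x = R (Q x)}"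

definition tame_factorization_property ::
  "('k, 'v::ab_group_add) graded_space \<Rightarrow> ('k, 'u::ab_group_add) graded_space \<Rightarrow>
   ('k, 'w::ab_group_add) graded_space \<Rightarrow> bool" where
  "tame_factorization_property E G F \<longleftrightarrow>
     (\<exists>S. mono S \<and> (\<forall>T\<in>factorable_operators E G F.
        \<exists>k0. \<forall>k\<ge>k0. continuity_index E F T k \<le> enat (S k)))"

section \<open>Koethe spaces\<close>

definition koethe_matrix :: "(nat \<Rightarrow> nat \<Rightarrow> real) \<Rightarrow> bool" where
  "koethe_matrix a \<longleftrightarrow>
     (\<forall>n k. 0 \<le> a n k \<and> a n k \<le> a n (Suc k)) \<and> (\<forall>n. \<exists>k. 0 < a n k)"

definition koethe_l1 :: "(nat \<Rightarrow> nat \<Rightarrow> real) \<Rightarrow> ('k::real_normed_field, nat \<Rightarrow> 'k) graded_space" where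
  "koethe_l1 a =
     \<lparr>points = {x. \<forall>k. summable (\<lambda>j. norm (x j) * a j k)},
      scale = (\<lambda>c x j. c * x j),
      seminorm = (\<lambda>k x. \<Sum>j. norm (x j) * a j k)\<rparr>"

definition koethe_linf :: "(nat \<Rightarrow> nat \<Rightarrow> real) \<Rightarrow> ('k::real_normed_field, nat \<Rightarrow> 'k) graded_space" where
  "koethe_linf a =
     \<lparr>points = {x. \<forall>k. bdd_above (range (\<lambda>j. norm (x j) * a j k))},
      scale = (\<lambda>c x j. c * x j),
      seminorm = (\<lambda>k x. SUP j. norm (x j) * a j k)\<rparr>"

section \<open>Arithmetic in the extended half-line\<close>

text \<open>
  On \<^typ>\<open>ennreal\<close> one has \<open>1 / 0 = \<infinity>\<close> and \<open>0 * \<infinity> = 0 / 0 = 0\<close>. A product of two maxima follows the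
  other convention \<open>0 * \<infinity> = \<infinity>\<close> and needs its own multiplication.
\<close>

definition max_mult :: "ennreal \<Rightarrow> ennreal \<Rightarrow> ennreal" where
  "max_mult u v = (if u = \<infinity> \<or> v = \<infinity> then \<infinity> else u * v)"

end

theory Submission imports Defs begin

text \<open>
  Evaluating an operator \<open>T = R Q\<close> on unit vectors gives the matrix \<open>y'\<^sub>j(y\<^sub>i)\<close> with \<open>y\<^sub>i = Q e\<^sub>i\<close> and \<open>y'\<^sub>j\<close> the
  \<open>j\<close>-th coordinate of \<open>R\<close>. Continuity of \<open>Q\<close> and \<open>R\<close> bounds both maxima of the estimate for a suitable
  \<open>\<phi>\<close>, so the estimate for \<open>\<phi>\<close> bounds the matrix, hence \<open>T\<close>.

  Conversely, let \<open>T\<close> be tame with \<open>S\<close> for all factorable \<open>T\<close> and suppose that the estimate fails, for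
  some \<open>\<phi>\<close>, at all \<open>k\<close> in an infinite set. Choose normalized violations \<open>y\<^sub>m, y'\<^sub>m, i\<^sub>m, j\<^sub>m\<close> such that every
  bad \<open>k\<close> is violated infinitely often. For bounded scalar sequences \<open>s, t\<close> the series
  \<open>Q\<^sub>s x = \<Sum>\<^sub>m s\<^sub>m x(i\<^sub>m) y\<^sub>m\<close> and \<open>R\<^sub>t y = \<Sum>\<^sub>m t\<^sub>m y'\<^sub>m(y) e\<^sub>j\<close>, where \<open>j = j\<^sub>m\<close>, define operators, and the matrix entries
  of \<open>R\<^sub>t Q\<^sub>s\<close> are bounded bilinear in \<open>(s, t)\<close>. By Baire's theorem the tameness of all \<open>R\<^sub>t Q\<^sub>s\<close> is uniform
  in \<open>(s, t)\<close> from some \<open>k\<^sub>0\<close> on, which for unit sequences contradicts the choice of the violations.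
\<close>

section \<open>Graded seminormed spaces\<close>

text \<open>Both Koethe spaces and \<open>G\<close> enter through this locale. The Hausdorff and
  completeness clauses are added in \<open>frechet_space\<close>, where series in \<open>G\<close>
  are summed.\<close>

locale graded_seminormed_space =
  fixes E :: "('k::real_normed_field, 'v::ab_group_add) graded_space"
  assumes vector_space: "vector_space (scale E)"
    and subspace: "module.subspace (scale E) (points E)"
    and seminorm: "\<And>k. is_seminorm_on (points E) (scale E) (seminorm E k)"
    and seminorm_Suc: "\<And>k x. x \<in> points E \<Longrightarrow> seminorm E k x \<le> seminorm E (Suc k) x"
begin

sublocale vector_space "scale E" by (rule vector_space)

lemma points_closed [simp, intro]:
  "0 \<in> points E"
  "x \<in> points E \<Longrightarrow> y \<in> points E \<Longrightarrow> x + y \<in> points E"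
  "x \<in> points E \<Longrightarrow> y \<in> points E \<Longrightarrow> x - y \<in> points E"
  "x \<in> points E \<Longrightarrow> - x \<in> points E"
  "x \<in> points E \<Longrightarrow> scale E c x \<in> points E"
  using subspace by (simp_all add: subspace_0 subspace_add subspace_diff subspace_neg subspace_scale)

lemma points_sum [simp, intro]: "(\<And>i. i \<in> I \<Longrightarrow> f i \<in> points E) \<Longrightarrow> sum f I \<in> points E"
  using subspace by (rule subspace_sum)

lemma seminorm_nonneg [simp]: "x \<in> points E \<Longrightarrow> 0 \<le> seminorm E k x"
  and seminorm_triangle: "x \<in> points E \<Longrightarrow> y \<in> points E \<Longrightarrow>
    seminorm E k (x + y) \<le> seminorm E k x + seminorm E k y"
  and seminorm_scale: "x \<in> points E \<Longrightarrow> seminorm E k (scale E c x) = norm c * seminorm E k x"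
  using seminorm[of k] by (auto simp: is_seminorm_on_def)

lemma seminorm_zero [simp]: "seminorm E k 0 = 0"
  using seminorm_scale[of 0 k 0] by simp

lemma seminorm_minus [simp]: "x \<in> points E \<Longrightarrow> seminorm E k (- x) = seminorm E k x"
  using seminorm_scale[of x k "-1"] by simp

lemma seminorm_commute: "x \<in> points E \<Longrightarrow> y \<in> points E \<Longrightarrow> seminorm E k (x - y) = seminorm E k (y - x)"
  using seminorm_minus[of "x - y" k] by simp

lemma seminorm_triangle_diff:
  assumes "x \<in> points E" "y \<in> points E" "z \<in> points E"
  shows "seminorm E k (x - z) \<le> seminorm E k (x - y) + seminorm E k (y - z)"
  using seminorm_triangle[of "x - y" "y - z" k] assms by simp

lemma seminorm_sum:
  "(\<And>i. i \<in> I \<Longrightarrow> f i \<in> points E) \<Longrightarrow> seminorm E k (sum f I) \<le> (\<Sum>i\<in>I. seminorm E k (f i))"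
proof (induction I rule: infinite_finite_induct)
  case (insert i I)
  then show ?case using seminorm_triangle[of "f i" "sum f I" k] by fastforce
qed auto

lemma seminorm_mono: "x \<in> points E \<Longrightarrow> k \<le> l \<Longrightarrow> seminorm E k x \<le> seminorm E l x"
  by (rule lift_Suc_mono_le[of "\<lambda>k. seminorm E k x"]) (auto intro: seminorm_Suc)

section \<open>Topology of a graded space and unit balls of its seminorms\<close>

lemma openin_ball:
  assumes "x \<in> points E" "0 < e"
  shows "openin (graded_topology E) {y \<in> points E. seminorm E k (y - x) < e}"
  unfolding graded_topology_def
  by (rule topology_generated_by_Basis, rule CollectI, intro exI conjI) (rule refl assms)+

lemma topspace_graded [simp]: "topspace (graded_topology E) = points E"
proof
  show "topspace (graded_topology E) \<subseteq> points E"
    unfolding graded_topology_def topology_generated_by_topspace by auto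
  show "points E \<subseteq> topspace (graded_topology E)"
  proof
    fix x assume "x \<in> points E"
    then have "x \<in> {y \<in> points E. seminorm E 0 (y - x) < 1}" by simp
    then show "x \<in> topspace (graded_topology E)"
      using openin_subset[OF openin_ball[OF \<open>x \<in> points E\<close> zero_less_one]] by blast
  qed
qed

text \<open>The generating balls have arbitrary centers, but by the triangle inequality each
  contains a smaller ball around any of its points. Finite intersections are handled by the larger
  of the two indices, because the grading increases.\<close>

lemma openin_imp_ball:
  assumes "openin (graded_topology E) U" "x \<in> U"
  shows "\<exists>k e. 0 < e \<and> {y \<in> points E. seminorm E k (y - x) < e} \<subseteq> U"
proof -
  have "generate_topology_on
     {{y \<in> points E. seminorm E k (y - x) < e} | x k e. x \<in> points E \<and> 0 < e} U"
    using assms(1) unfolding graded_topology_def openin_topology_generated_by_iff .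
  then show ?thesis using assms(2)
  proof (induction arbitrary: x)
    case Empty
    then show ?case by simp
  next
    case (Int a b)
    obtain k e l d where *: "0 < e" "{y \<in> points E. seminorm E k (y - x) < e} \<subseteq> a"
      "0 < d" "{y \<in> points E. seminorm E l (y - x) < d} \<subseteq> b"
      using Int by (meson IntE)
    have "x \<in> points E"
      using Int.hyps(1) Int.prems openin_subset[of "graded_topology E" a]
      unfolding topspace_graded unfolding graded_topology_def openin_topology_generated_by_iff by blast
    have "{y \<in> points E. seminorm E (max k l) (y - x) < min e d} \<subseteq> a \<inter> b"
    proof safe
      fix y assume y: "y \<in> points E" "seminorm E (max k l) (y - x) < min e d"
      have "seminorm E k (y - x) < e" "seminorm E l (y - x) < d"
        using y \<open>x \<in> points E\<close> seminorm_mono[of "y - x" k "max k l"] seminorm_mono[of "y - x" l "max k l"]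
        by auto
      then show "y \<in> a" "y \<in> b" using * y(1) by auto
    qed
    then show ?case using \<open>0 < e\<close> \<open>0 < d\<close> by (metis min_less_iff_conj)
  next
    case (UN K)
    then show ?case by (meson UnionE Union_upper order_trans)
  next
    case (Basis s)
    then obtain z k e where s: "s = {y \<in> points E. seminorm E k (y - z) < e}" "z \<in> points E" by blast
    have "{y \<in> points E. seminorm E k (y - x) < e - seminorm E k (x - z)} \<subseteq> s"
      using s Basis.prems seminorm_triangle_diff[of _ x z k] by force
    moreover have "0 < e - seminorm E k (x - z)" using s Basis.prems by simp
    ultimately show ?case by blast
  qed
qed

text \<open>Homogeneity turns a bound on the unit ball into an estimate on the whole space. This is
  the common core of \<open>operator_norm_le_iff\<close> and
  \<open>dual_norm_mult_le_iff\<close>.\<close>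

lemma SUP_unit_ball_le_iff:
  assumes f: "\<And>c x. x \<in> points E \<Longrightarrow> f (scale E c x) = norm c * f x"
    and "0 \<le> M"
  shows "(SUP x\<in>{x \<in> points E. seminorm E k x \<le> 1}. ennreal (f x)) \<le> ennreal M \<longleftrightarrow>
    (\<forall>x\<in>points E. f x \<le> M * seminorm E k x)"
proof
  assume L: "(SUP x\<in>{x \<in> points E. seminorm E k x \<le> 1}. ennreal (f x)) \<le> ennreal M"
  have ball: "f x \<le> M" if "x \<in> points E" "seminorm E k x \<le> 1" for x
    using L that \<open>0 \<le> M\<close> by (force simp: SUP_le_iff)
  show "\<forall>x\<in>points E. f x \<le> M * seminorm E k x"
  proof
    fix x assume x: "x \<in> points E"
    \<comment> \<open>Normalizing by numbers \<open>t\<close> strictly above the seminorm, which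
      then decrease to it, covers vectors of seminorm 0 as well.\<close>
    have *: "f x \<le> M * t" if t: "seminorm E k x < t" for t
    proof -
      have "0 < t" using t x seminorm_nonneg[of x k] by linarith
      then have "f (scale E (of_real (1 / t)) x) \<le> M"
        using x t by (intro ball) (auto simp: seminorm_scale norm_divide divide_simps)
      then show ?thesis using x \<open>0 < t\<close> by (simp add: f norm_divide divide_simps mult.commute)
    qed
    have "((\<lambda>t. M * t) \<longlongrightarrow> M * seminorm E k x) (at_right (seminorm E k x))"
      by (intro tendsto_intros)
    moreover have "\<forall>\<^sub>F t in at_right (seminorm E k x). f x \<le> M * t"
      using * by (auto simp: eventually_at_filter)
    ultimately show "f x \<le> M * seminorm E k x"
      using tendsto_lowerbound trivial_limit_at_right_real by blast
  qed
next
  assume R: "\<forall>x\<in>points E. f x \<le> M * seminorm E k x"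
  show "(SUP x\<in>{x \<in> points E. seminorm E k x \<le> 1}. ennreal (f x)) \<le> ennreal M"
  proof (rule SUP_least)
    fix x assume "x \<in> {x \<in> points E. seminorm E k x \<le> 1}"
    then show "ennreal (f x) \<le> ennreal M"
      using R mult_left_mono[of "seminorm E k x" 1 M] \<open>0 \<le> M\<close> by (force intro: ennreal_leI order_trans)
  qed
qed

end

section \<open>Continuity of operators and functionals as seminorm estimates\<close>

lemma linear_on_zero:
  assumes "graded_seminormed_space E" "graded_seminormed_space F" "linear_on (points E) (scale E) (scale F) T"
  shows "T 0 = 0"
proof -
  interpret E: graded_seminormed_space E by fact
  interpret F: graded_seminormed_space F by fact
  have "T (scale E 0 0) = scale F 0 (T 0)" using assms(3) E.points_closed(1) unfolding linear_on_def by blast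
  then show ?thesis by simp
qed

lemma linear_on_diff:
  assumes "graded_seminormed_space E" "linear_on (points E) (scale E) s T" "x \<in> points E" "y \<in> points E"
  shows "T (x - y) = T x - T y"
proof -
  interpret E: graded_seminormed_space E by fact
  have "T (x - y + y) = T (x - y) + T y" using assms(2-) E.points_closed unfolding linear_on_def by blast
  then show ?thesis by simp
qed

text \<open>By linearity continuity is decided at 0: the preimage of a unit ball contains a ball
  around 0, and scaling yields the estimate. Conversely, the estimate is applied to
  differences.\<close>

lemma operators_iff:
  fixes E :: "('k::real_normed_field, 'v::ab_group_add) graded_space"
    and F :: "('k, 'w::ab_group_add) graded_space"
  assumes "graded_seminormed_space E" "graded_seminormed_space F"
  shows "T \<in> operators E F \<longleftrightarrow> linear_on (points E) (scale E) (scale F) T \<and> T ` points E \<subseteq> points F \<and>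
    (\<forall>k. \<exists>r M. 0 \<le> M \<and> (\<forall>x\<in>points E. seminorm F k (T x) \<le> M * seminorm E r x))"
    (is "?L \<longleftrightarrow> ?R")
proof -
  interpret E: graded_seminormed_space E by fact
  interpret F: graded_seminormed_space F by fact
  show ?thesis
  proof
    assume ?L
    then have lin: "linear_on (points E) (scale E) (scale F) T"
      and cont: "continuous_map (graded_topology E) (graded_topology F) T" by (auto simp: operators_def)
    have img: "T x \<in> points F" if "x \<in> points E" for x
      using continuous_map_image_subset_topspace[OF cont] that by auto
    have "\<exists>r M. 0 \<le> M \<and> (\<forall>x\<in>points E. seminorm F k (T x) \<le> M * seminorm E r x)" for k
    proof -
      let ?U = "{x \<in> points E. T x \<in> {w \<in> points F. seminorm F k (w - 0) < 1}}"
      have "openin (graded_topology E) ?U"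
        using openin_continuous_map_preimage[OF cont F.openin_ball[of 0 1 k]] by simp
      moreover have "0 \<in> ?U" using linear_on_zero[OF assms lin] by simp
      ultimately obtain r e where e: "0 < e" "{y \<in> points E. seminorm E r (y - 0) < e} \<subseteq> ?U"
        using E.openin_imp_ball by blast
      have hom: "T (scale E c x) = scale F c (T x)" if "x \<in> points E" for c x
        using lin that by (auto simp: linear_on_def)
      have sub: "seminorm F k (T x) \<le> 1" if "x \<in> points E" "seminorm E r x < e" for x
        using e that by force
      \<comment> \<open>Scaling by \<open>e / 2\<close> moves the closed unit ball strictly inside
        the open ball of radius \<open>e\<close>, whence the constant \<open>2 / e\<close>.\<close>
      have "(SUP x\<in>{x \<in> points E. seminorm E r x \<le> 1}. ennreal (seminorm F k (T x))) \<le> ennreal (2 / e)"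
      proof (rule SUP_least, rule ennreal_leI)
        fix x assume "x \<in> {x \<in> points E. seminorm E r x \<le> 1}"
        then have "x \<in> points E" "seminorm E r x \<le> 1" by auto
        moreover have "seminorm E r (scale E (of_real (e / 2)) x) < e"
        proof -
          have "(e/2) * seminorm E r x \<le> (e/2) * 1" using \<open>0 < e\<close> calculation by (intro mult_left_mono) auto
          then show ?thesis
            using calculation \<open>0 < e\<close> by (simp add: E.seminorm_scale)
        qed
        ultimately have "seminorm F k (T (scale E (of_real (e / 2)) x)) \<le> 1"
          by (intro sub) auto
        then show "seminorm F k (T x) \<le> 2 / e"
          using \<open>0 < e\<close> \<open>x \<in> points E\<close> by (simp add: hom F.seminorm_scale img norm_divide field_simps)
      qed
      then have "\<forall>x\<in>points E. seminorm F k (T x) \<le> 2 / e * seminorm E r x"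
        using \<open>0 < e\<close> by (subst (asm) E.SUP_unit_ball_le_iff) (auto simp: hom F.seminorm_scale img)
      then show ?thesis using \<open>0 < e\<close> by (intro exI[of _ r] exI[of _ "2 / e"]) auto
    qed
    then show ?R using lin img by blast
  next
    assume R: ?R
    then have lin: "linear_on (points E) (scale E) (scale F) T" and img: "\<And>x. x \<in> points E \<Longrightarrow> T x \<in> points F"
      by auto
    have "continuous_map (graded_topology E) (graded_topology F) T"
      unfolding continuous_map_def
    proof (intro conjI allI impI)
      show "T \<in> topspace (graded_topology E) \<rightarrow> topspace (graded_topology F)" using img by auto
      fix U assume U: "openin (graded_topology F) U"
      show "openin (graded_topology E) {x \<in> topspace (graded_topology E). T x \<in> U}"
      proof (subst openin_subopen, safe)
        fix x assume x: "x \<in> topspace (graded_topology E)" "T x \<in> U"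
        then obtain k e where e: "0 < e" "{y \<in> points F. seminorm F k (y - T x) < e} \<subseteq> U"
          using F.openin_imp_ball[OF U] by blast
        obtain r M where M: "0 \<le> M" "\<And>x. x \<in> points E \<Longrightarrow> seminorm F k (T x) \<le> M * seminorm E r x"
          using R by blast
        \<comment> \<open>The summand 1 keeps the radius meaningful when
          \<open>M = 0\<close>.\<close>
        let ?V = "{y \<in> points E. seminorm E r (y - x) < e / (M + 1)}"
        have "openin (graded_topology E) ?V" using x e M by (intro E.openin_ball) auto
        moreover have "x \<in> ?V" using x e M by simp
        moreover have "T y \<in> U" if y: "y \<in> ?V" for y
        proof -
          have "seminorm F k (T y - T x) = seminorm F k (T (y - x))"
            using linear_on_diff[OF assms(1) lin] y x by simp
          also have "\<dots> \<le> M * seminorm E r (y - x)" using x y by (intro M) auto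
          also have "\<dots> \<le> (M + 1) * seminorm E r (y - x)" using x y by (intro mult_right_mono) auto
          also have "\<dots> < e" using y M by (simp add: field_simps)
          finally show ?thesis using e img y by auto
        qed
        ultimately show "\<exists>V. openin (graded_topology E) V \<and> x \<in> V \<and>
            V \<subseteq> {x \<in> topspace (graded_topology E). T x \<in> U}"
          by (intro exI[of _ ?V]) auto
      qed
    qed
    then show ?L using lin by (simp add: operators_def)
  qed
qed

text \<open>The second half of \<open>operators_iff\<close> with the scalar field as target. It
  serves to place the coordinates of an operator into \<open>koethe_linf C\<close> in
  \<open>dual G\<close>.\<close>

lemma dualI:
  fixes E :: "('k::real_normed_field, 'v::ab_group_add) graded_space"
  assumes "graded_seminormed_space E" and lin: "linear_on (points E) (scale E) (*) f"
    and M: "\<And>x. x \<in> points E \<Longrightarrow> norm (f x) \<le> M * seminorm E r x"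
  shows "f \<in> dual E"
proof -
  interpret E: graded_seminormed_space E by fact
  have "continuous_map (graded_topology E) euclidean f"
    unfolding continuous_map_def
  proof (intro conjI allI impI)
    fix U :: "'k set" assume "openin euclidean U"
    then have U: "open U" by simp
    show "openin (graded_topology E) {x \<in> topspace (graded_topology E). f x \<in> U}"
    proof (subst openin_subopen, safe)
      fix x assume x: "x \<in> topspace (graded_topology E)" "f x \<in> U"
      then obtain e where e: "0 < e" "ball (f x) e \<subseteq> U"
        using U open_contains_ball by blast
      let ?V = "{y \<in> points E. seminorm E r (y - x) < e / (\<bar>M\<bar> + 1)}"
      have "openin (graded_topology E) ?V" using x e by (intro E.openin_ball) auto
      moreover have "x \<in> ?V" using x e by simp
      moreover have "f y \<in> U" if y: "y \<in> ?V" for y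
      proof -
        have "norm (f y - f x) = norm (f (y - x))"
          using linear_on_diff[OF assms(1) lin] y x by simp
        also have "\<dots> \<le> M * seminorm E r (y - x)" using x y by (intro M) auto
        also have "\<dots> \<le> (\<bar>M\<bar> + 1) * seminorm E r (y - x)" using x y by (intro mult_right_mono) auto
        also have "\<dots> < e" using y by (simp add: field_simps)
        finally show ?thesis using e by (auto simp: dist_norm norm_minus_commute)
      qed
      ultimately show "\<exists>V. openin (graded_topology E) V \<and> x \<in> V \<and>
          V \<subseteq> {x \<in> topspace (graded_topology E). f x \<in> U}"
        by (intro exI[of _ ?V]) auto
    qed
  qed auto
  then show ?thesis using lin by (simp add: dual_def)
qed

lemma operator_norm_le_iff:
  assumes "graded_seminormed_space E" "graded_seminormed_space F" "T \<in> operators E F" "0 \<le> M"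
  shows "operator_norm E F k r T \<le> ennreal M \<longleftrightarrow> (\<forall>x\<in>points E. seminorm F k (T x) \<le> M * seminorm E r x)"
proof -
  interpret E: graded_seminormed_space E by fact
  interpret F: graded_seminormed_space F by fact
  show ?thesis
    using assms(3) unfolding operators_iff[OF assms(1,2)] operator_norm_def linear_on_def
    by (intro E.SUP_unit_ball_le_iff \<open>0 \<le> M\<close>) (auto simp: F.seminorm_scale image_subset_iff)
qed

text \<open>An infimum of natural numbers that is at most \<open>s\<close> is bounded by an actual
  member \<open>r \<le> s\<close>, and an estimate at \<open>r\<close> passes to \<open>s\<close>
  because the grading increases.\<close>

lemma continuity_index_le_iff:
  assumes "graded_seminormed_space E" "graded_seminormed_space F" "T \<in> operators E F"
  shows "continuity_index E F T k \<le> enat s \<longleftrightarrow>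
    (\<exists>M\<ge>0. \<forall>x\<in>points E. seminorm F k (T x) \<le> M * seminorm E s x)"
proof -
  interpret E: graded_seminormed_space E by fact
  interpret F: graded_seminormed_space F by fact
  have fin: "operator_norm E F k r T < \<infinity> \<longleftrightarrow>
      (\<exists>M\<ge>0. \<forall>x\<in>points E. seminorm F k (T x) \<le> M * seminorm E r x)" for r
  proof
    assume "operator_norm E F k r T < \<infinity>"
    then obtain M where "0 \<le> M" "operator_norm E F k r T = ennreal M"
      by (cases "operator_norm E F k r T") auto
    then show "\<exists>M\<ge>0. \<forall>x\<in>points E. seminorm F k (T x) \<le> M * seminorm E r x"
      using operator_norm_le_iff[OF assms, of M k r] by auto
  next
    assume "\<exists>M\<ge>0. \<forall>x\<in>points E. seminorm F k (T x) \<le> M * seminorm E r x"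
    then obtain M where "operator_norm E F k r T \<le> ennreal M"
      using operator_norm_le_iff[OF assms, of _ k r] by auto
    then show "operator_norm E F k r T < \<infinity>"
      using order_le_less_trans by fastforce
  qed
  show ?thesis
  proof
    assume L: "continuity_index E F T k \<le> enat s"
    let ?R = "{r. operator_norm E F k r T < \<infinity>}"
    have "\<exists>r\<in>?R. r \<le> s"
    proof (rule ccontr)
      assume "\<not> ?thesis"
      then have "enat (Suc s) \<le> continuity_index E F T k"
        unfolding continuity_index_def by (intro INF_greatest) (auto simp: not_le Suc_le_eq)
      then show False using order_trans[OF _ L] by fastforce
    qed
    then obtain r M where r: "r \<le> s" "0 \<le> M" "\<And>x. x \<in> points E \<Longrightarrow> seminorm F k (T x) \<le> M * seminorm E r x"
      using fin by auto
    then have "seminorm F k (T x) \<le> M * seminorm E s x" if "x \<in> points E" for x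
      using E.seminorm_mono[OF that r(1)] that by (meson mult_left_mono order_trans)
    then show "\<exists>M\<ge>0. \<forall>x\<in>points E. seminorm F k (T x) \<le> M * seminorm E s x" using r(2) by blast
  next
    assume "\<exists>M\<ge>0. \<forall>x\<in>points E. seminorm F k (T x) \<le> M * seminorm E s x"
    then show "continuity_index E F T k \<le> enat s"
      unfolding continuity_index_def using fin[of s] by (intro INF_lower) auto
  qed
qed

text \<open>For \<open>c > 0\<close> the weight moves into the supremum. For \<open>c = 0\<close>
  the dual norm may be infinite, but \<open>\<infinity> * 0 = 0\<close> makes both sides
  true.\<close>

lemma dual_norm_mult_le_iff:
  fixes E :: "('k::real_normed_field, 'v::ab_group_add) graded_space"
  assumes "graded_seminormed_space E" and lin: "linear_on (points E) (scale E) (*) f" and "0 \<le> c" "0 \<le> M"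
  shows "dual_norm E k f * ennreal c \<le> ennreal M \<longleftrightarrow> (\<forall>x\<in>points E. norm (f x) * c \<le> M * seminorm E k x)"
proof (cases "c = 0")
  case True
  interpret E: graded_seminormed_space E by fact
  show ?thesis using True \<open>0 \<le> M\<close> by simp
next
  case False
  interpret E: graded_seminormed_space E by fact
  have "dual_norm E k f * ennreal c =
      (SUP x\<in>{x \<in> points E. seminorm E k x \<le> 1}. ennreal (norm (f x) * c))"
    unfolding dual_norm_def SUP_mult_right_ennreal using \<open>0 \<le> c\<close> by (simp add: ennreal_mult)
  moreover have "\<dots> \<le> ennreal M \<longleftrightarrow> (\<forall>x\<in>points E. norm (f x) * c \<le> M * seminorm E k x)"
    using lin by (intro E.SUP_unit_ball_le_iff \<open>0 \<le> M\<close>) (auto simp: linear_on_def norm_mult)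
  ultimately show ?thesis by simp
qed

section \<open>Uniform boundedness for families of bilinear maps\<close>

text \<open>The threshold \<open>k0\<close> in \<open>pointwise\<close> varies with
  \<open>(s, t)\<close>, so Baire's theorem is applied to all bad \<open>k\<close> at once. If the
  bad set \<open>K\<close> were unbounded, the countably many closed sets \<open>F k n\<close> with
  \<open>k \<in> K\<close> would cover the product space, and one of them would have interior.
  Bilinearity transports that ball to the origin and gives a bound at a bad
  \<open>k\<close>.\<close>

lemma eventually_bounded_bilinear_family:
  fixes b :: "'l \<Rightarrow> 'a::{real_normed_vector, complete_space} \<Rightarrow> 'b::{real_normed_vector, complete_space} \<Rightarrow> 'c::real_normed_vector"
    and c a :: "nat \<Rightarrow> 'l \<Rightarrow> real"
  assumes bil: "\<And>l. bounded_bilinear (b l)"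
    and nonneg: "\<And>k l. 0 \<le> c k l" "\<And>k l. 0 \<le> a k l"
    and pointwise: "\<And>s t. \<exists>k0. \<forall>k\<ge>k0. \<exists>M. \<forall>l. c k l * norm (b l s t) \<le> M * a k l"
  shows "\<exists>k0. \<forall>k\<ge>k0. \<exists>M\<ge>0. \<forall>l s t. c k l * norm (b l s t) \<le> M * norm s * norm t * a k l"
proof (rule ccontr)
  define K where "K = {k. \<nexists>M. M \<ge> 0 \<and> (\<forall>l s t. c k l * norm (b l s t) \<le> M * norm s * norm t * a k l)}"
  define F where "F k n = {x. \<forall>l. c k l * norm (b l (fst x) (snd x)) \<le> real n * a k l}" for k n
  assume "\<not> ?thesis"
  then have K: "\<And>k0. \<exists>k\<in>K. k0 \<le> k" unfolding K_def by blast
  have closed: "closed (F k n)" for k n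
  proof -
    have "continuous_on UNIV (\<lambda>x. c k l * norm (b l (fst x) (snd x)))" for l
      by (intro continuous_intros bounded_bilinear.continuous_on[OF bil])
    then show ?thesis unfolding F_def by (intro closed_Collect_all closed_Collect_le) auto
  qed
  have empty: "interior (F k n) = {}" if "k \<in> K" for k n
  proof (rule ccontr)
    assume "interior (F k n) \<noteq> {}"
    then obtain s0 t0 e where e: "0 < e" "ball (s0, t0) e \<subseteq> F k n"
      by (metis all_not_in_conv mem_interior surj_pair)
    \<comment> \<open>Half the radius, because the distance in the product is at most the sum of the
      two perturbations.\<close>
    define d where "d = e / 2"
    have d: "0 < d" using e by (simp add: d_def)
    have F: "(s0 + x, t0 + y) \<in> F k n" if "norm x < d" "norm y < d" for x y
    proof -
      have "dist (s0, t0) (s0 + x, t0 + y) \<le> norm x + norm y"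
        using real_sqrt_sum_squares_triangle_ineq[of "norm x" 0 0 "norm y"] by (simp add: dist_Pair_Pair dist_norm norm_Pair)
      also have "\<dots> < e" using that by (simp add: d_def)
      finally show ?thesis using e by auto
    qed
    have small: "c k l * norm (b l x y) \<le> real n * a k l" if xy: "norm x < d" "norm y < d" for l x y
    proof -
      interpret bounded_bilinear "b l" by (rule bil)
      txt \<open>Polarization expresses \<open>4 b(x,y)\<close> by the values of \<open>b\<close> at \<open>(s0 \<plusminus> x, t0 \<plusminus> y)\<close>.\<close>
      have "4 *\<^sub>R b l x y = (b l (s0 + x) (t0 + y) - b l (s0 + - x) (t0 + y))
          - (b l (s0 + x) (t0 + - y) - b l (s0 + - x) (t0 + - y))"
        unfolding add_left add_right minus_left minus_right
        using scaleR_add_left[of 2 2 "b l x y"] by (simp add: scaleR_2)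
      then have "norm (4 *\<^sub>R b l x y) \<le> norm (b l (s0 + x) (t0 + y) - b l (s0 + - x) (t0 + y))
          + norm (b l (s0 + x) (t0 + - y) - b l (s0 + - x) (t0 + - y))"
        by (metis norm_triangle_ineq4)
      also have "\<dots> \<le> (norm (b l (s0 + x) (t0 + y)) + norm (b l (s0 + - x) (t0 + y)))
          + (norm (b l (s0 + x) (t0 + - y)) + norm (b l (s0 + - x) (t0 + - y)))"
        by (intro add_mono norm_triangle_ineq4)
      finally have "4 * norm (b l x y) \<le> \<dots>" by simp
      then have "c k l * (4 * norm (b l x y)) \<le> c k l * \<dots>" by (rule mult_left_mono) (rule nonneg)
      moreover have "c k l * norm (b l (s0 + x) (t0 + y)) \<le> real n * a k l"
        "c k l * norm (b l (s0 + - x) (t0 + y)) \<le> real n * a k l"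
        "c k l * norm (b l (s0 + x) (t0 + - y)) \<le> real n * a k l"
        "c k l * norm (b l (s0 + - x) (t0 + - y)) \<le> real n * a k l"
        using F[of x y] F[of "- x" y] F[of x "- y"] F[of "- x" "- y"] xy by (auto simp: F_def)
      ultimately show ?thesis by (simp add: distrib_left)
    qed
    have "c k l * norm (b l s t) \<le> real n * (2 / d)\<^sup>2 * norm s * norm t * a k l" for l s t
    proof (cases "s = 0 \<or> t = 0")
      case True
      then show ?thesis
        using bounded_bilinear.zero_left[OF bil] bounded_bilinear.zero_right[OF bil] by auto
    next
      case False
      interpret bounded_bilinear "b l" by (rule bil)
      \<comment> \<open>Both arguments are scaled to norm \<open>d / 2\<close>, where
        \<open>small\<close> applies; this produces the factor
        \<open>(2 / d)\<^sup>2\<close>.\<close>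
      let ?u = "d / (2 * norm s)" and ?v = "d / (2 * norm t)"
      have "c k l * norm (b l (?u *\<^sub>R s) (?v *\<^sub>R t)) \<le> real n * a k l"
        using False d by (intro small) auto
      then have "?u * ?v * (c k l * norm (b l s t)) \<le> real n * a k l"
        using d by (simp add: scaleR_left scaleR_right mult_ac)
      then show ?thesis using False d by (simp add: field_simps power2_eq_square)
    qed
    moreover have "0 \<le> real n * (2 / d)\<^sup>2" by simp
    ultimately show False using \<open>k \<in> K\<close> unfolding K_def by blast
  qed
  have "(euclidean :: ('a \<times> 'b) topology) interior_of \<Union>(case_prod F ` (K \<times> UNIV)) = {}"
    unfolding mtopology_is_euclidean[symmetric]
    by (rule Met_TC.metric_Baire_category_alt)
      (use closed empty complete_UNIV in auto)
  moreover have "\<Union>(case_prod F ` (K \<times> UNIV)) = UNIV"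
  proof (rule UNIV_eq_I[symmetric])
    fix x :: "'a \<times> 'b"
    obtain k0 where k0: "\<And>k. k \<ge> k0 \<Longrightarrow> \<exists>M. \<forall>l. c k l * norm (b l (fst x) (snd x)) \<le> M * a k l"
      using pointwise by blast
    \<comment> \<open>\<open>k0\<close> belongs to this particular pair \<open>x\<close>;
      unboundedness of \<open>K\<close> supplies a bad index beyond it.\<close>
    obtain k where "k \<in> K" "k0 \<le> k" using K by blast
    then obtain M where M: "\<And>l. c k l * norm (b l (fst x) (snd x)) \<le> M * a k l" using k0 by blast
    obtain n where n: "M \<le> real n" using real_arch_simple by blast
    have "c k l * norm (b l (fst x) (snd x)) \<le> real n * a k l" for l
      using M[of l] mult_right_mono[OF n nonneg(2)[of k l]] by linarith
    then have "x \<in> F k n" by (simp add: F_def)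
    then show "x \<in> \<Union>(case_prod F ` (K \<times> UNIV))" using \<open>k \<in> K\<close> by auto
  qed
  ultimately show False by simp
qed

section \<open>Absolutely convergent series in Frechet spaces\<close>

text \<open>Convergence is expressed in every seminorm instead of through \<open>limitin\<close>,
  which reduces limit laws to real sequences. Membership in \<open>points G\<close> is included
  because the seminorms are controlled only there.\<close>

definition graded_sums ::
  "('k::real_normed_field, 'v::ab_group_add) graded_space \<Rightarrow> (nat \<Rightarrow> 'v) \<Rightarrow> 'v \<Rightarrow> bool" where
  "graded_sums G z l \<longleftrightarrow> (\<forall>m. z m \<in> points G) \<and> l \<in> points G \<and>
     (\<forall>k. (\<lambda>n. seminorm G k ((\<Sum>m<n. z m) - l)) \<longlonglongrightarrow> 0)"

definition graded_suminf ::
  "('k::real_normed_field, 'v::ab_group_add) graded_space \<Rightarrow> (nat \<Rightarrow> 'v) \<Rightarrow> 'v" where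
  "graded_suminf G z = (THE l. graded_sums G z l)"

locale frechet_space =
  fixes G :: "('k::real_normed_field, 'g::ab_group_add) graded_space"
  assumes frechet: "graded_frechet_space G"
begin

sublocale graded_seminormed_space G
  using frechet by unfold_locales (simp_all add: graded_frechet_space_def vector_space_def)

lemma graded_sums_unique:
  assumes "graded_sums G z l" "graded_sums G z l'"
  shows "l = l'"
proof -
  note l = assms[unfolded graded_sums_def]
  have "seminorm G k (l - l') = 0" for k
  proof -
    have "(\<lambda>n. seminorm G k ((\<Sum>m<n. z m) - l) + seminorm G k ((\<Sum>m<n. z m) - l')) \<longlonglongrightarrow> 0 + 0"
      using l by (intro tendsto_add) auto
    moreover have "seminorm G k (l - l') \<le>
        seminorm G k ((\<Sum>m<n. z m) - l) + seminorm G k ((\<Sum>m<n. z m) - l')" for n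
      using seminorm_triangle_diff[of l "\<Sum>m<n. z m" l' k] seminorm_commute[of l "\<Sum>m<n. z m" k] l by simp
    ultimately have "seminorm G k (l - l') \<le> 0"
      using LIMSEQ_le_const by fastforce
    then show ?thesis using l by (intro antisym) auto
  qed
  then have "l - l' = 0" using frechet l unfolding graded_frechet_space_def by blast
  then show ?thesis by simp
qed

lemma graded_suminf_eq: "graded_sums G z l \<Longrightarrow> graded_suminf G z = l"
  unfolding graded_suminf_def using graded_sums_unique by blast

text \<open>Absolute convergence in each seminorm makes the partial sums Cauchy. Completeness yields
  a topological limit, and testing it on balls gives convergence in every seminorm.\<close>

lemma graded_sums_suminf:
  assumes z: "\<And>m. z m \<in> points G" and sm: "\<And>k. summable (\<lambda>m. seminorm G k (z m))"
  shows "graded_sums G z (graded_suminf G z)"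
proof -
  let ?X = "\<lambda>n. \<Sum>m<n. z m"
  have "\<exists>N. \<forall>m\<ge>N. \<forall>n\<ge>N. seminorm G k (?X m - ?X n) < e" if "0 < e" for k e
  proof -
    obtain N where N: "\<And>m n. N \<le> m \<Longrightarrow> norm (\<Sum>i=m..<n. seminorm G k (z i)) < e"
      using sm[of k] \<open>0 < e\<close> unfolding summable_Cauchy by blast
    have *: "seminorm G k (?X n - ?X m) < e" if "N \<le> m" "m \<le> n" for m n
    proof -
      have "?X n - ?X m = (\<Sum>i=m..<n. z i)"
        using sum_diff_nat_ivl[of 0 m n z] that by (simp add: lessThan_atLeast0)
      then have "seminorm G k (?X n - ?X m) \<le> (\<Sum>i=m..<n. seminorm G k (z i))"
        using seminorm_sum[of "{m..<n}" z k] z by simp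
      also have "\<dots> < e" using N[of m n] that by simp
      finally show ?thesis .
    qed
    have "seminorm G k (?X m - ?X n) < e" if "N \<le> m" "N \<le> n" for m n
      using *[of m n] *[of n m] that z seminorm_commute[of "?X m" "?X n" k] by (cases "m \<le> n") auto
    then show ?thesis by blast
  qed
  then obtain l where l: "limitin (graded_topology G) ?X l sequentially"
    using frechet z unfolding graded_frechet_space_def by (metis points_sum)
  then have "l \<in> points G" using limitin_topspace by fastforce
  have "(\<lambda>n. seminorm G k (?X n - l)) \<longlonglongrightarrow> 0" for k
  proof (rule LIMSEQ_I)
    fix e :: real assume "0 < e"
    then have "\<forall>\<^sub>F n in sequentially. ?X n \<in> {y \<in> points G. seminorm G k (y - l) < e}"
      using l openin_ball[OF \<open>l \<in> points G\<close>, of e k] \<open>l \<in> points G\<close> unfolding limitin_def by auto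
    then show "\<exists>N. \<forall>n\<ge>N. norm (seminorm G k (?X n - l) - 0) < e"
      using z \<open>l \<in> points G\<close> by (auto simp: eventually_sequentially)
  qed
  then have "graded_sums G z l" using z \<open>l \<in> points G\<close> by (simp add: graded_sums_def)
  then show ?thesis using graded_suminf_eq by blast
qed

lemma graded_sums_add:
  assumes "graded_sums G z l" "graded_sums G z' l'"
  shows "graded_sums G (\<lambda>m. z m + z' m) (l + l')"
proof -
  note l = assms[unfolded graded_sums_def]
  have "(\<lambda>n. seminorm G k ((\<Sum>m<n. z m + z' m) - (l + l'))) \<longlonglongrightarrow> 0" for k
  proof (rule tendsto_sandwich[OF _ _ tendsto_const])
    show "(\<lambda>n. seminorm G k ((\<Sum>m<n. z m) - l) + seminorm G k ((\<Sum>m<n. z' m) - l')) \<longlonglongrightarrow> 0"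
      using l by (intro tendsto_add_zero) auto
    show "\<forall>\<^sub>F n in sequentially. seminorm G k ((\<Sum>m<n. z m + z' m) - (l + l'))
        \<le> seminorm G k ((\<Sum>m<n. z m) - l) + seminorm G k ((\<Sum>m<n. z' m) - l')"
    proof (intro always_eventually allI)
      fix n
      have *: "(\<Sum>m<n. z m + z' m) - (l + l') = ((\<Sum>m<n. z m) - l) + ((\<Sum>m<n. z' m) - l')"
        by (simp add: sum.distrib algebra_simps)
      show "seminorm G k ((\<Sum>m<n. z m + z' m) - (l + l'))
          \<le> seminorm G k ((\<Sum>m<n. z m) - l) + seminorm G k ((\<Sum>m<n. z' m) - l')"
        unfolding * using l by (intro seminorm_triangle) auto
    qed
  qed (use l in simp)
  then show ?thesis using l by (simp add: graded_sums_def)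
qed

lemma graded_sums_scale:
  assumes "graded_sums G z l"
  shows "graded_sums G (\<lambda>m. scale G c (z m)) (scale G c l)"
proof -
  note l = assms[unfolded graded_sums_def]
  have "(\<lambda>n. norm c * seminorm G k ((\<Sum>m<n. z m) - l)) \<longlonglongrightarrow> 0" for k
    using l by (intro tendsto_mult_right_zero) auto
  moreover have "seminorm G k ((\<Sum>m<n. scale G c (z m)) - scale G c l) =
      norm c * seminorm G k ((\<Sum>m<n. z m) - l)" for k n
    using l by (simp add: scale_sum_right[symmetric] scale_right_diff_distrib[symmetric] seminorm_scale
        del: scale_right_diff_distrib)
  ultimately show ?thesis using l by (simp add: graded_sums_def)
qed

lemma graded_sums_single:
  assumes "\<And>m. m \<noteq> m0 \<Longrightarrow> z m = 0" "z m0 \<in> points G"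
  shows "graded_sums G z (z m0)"
proof -
  have "(\<Sum>m<n. z m) = z m0" if "m0 < n" for n
    using assms(1) that by (subst sum.remove[of _ m0]) (auto intro: sum.neutral)
  then have "\<forall>\<^sub>F n in sequentially. seminorm G k ((\<Sum>m<n. z m) - z m0) = 0" for k
    by (auto simp: eventually_sequentially intro!: exI[of _ "Suc m0"])
  moreover have "z m \<in> points G" for m using assms by (cases "m = m0") auto
  ultimately show ?thesis by (simp add: graded_sums_def tendsto_eventually)
qed

lemma graded_sums_seminorm_le:
  assumes "graded_sums G z l" "summable c" "\<And>m. seminorm G k (z m) \<le> c m"
  shows "seminorm G k l \<le> suminf c"
proof -
  note l = assms(1)[unfolded graded_sums_def]
  have c: "0 \<le> c m" for m using order_trans[OF seminorm_nonneg assms(3)] l by blast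
  have "seminorm G k l \<le> seminorm G k ((\<Sum>m<n. z m) - l) + suminf c" for n
  proof -
    have "seminorm G k (\<Sum>m<n. z m) \<le> suminf c"
      using seminorm_sum[of "{..<n}" z k] sum_mono[of "{..<n}" "\<lambda>m. seminorm G k (z m)" c]
        sum_le_suminf[OF assms(2), of "{..<n}"] assms(3) c l by fastforce
    then show ?thesis
      using seminorm_triangle_diff[of l "\<Sum>m<n. z m" 0 k] seminorm_commute[of l "\<Sum>m<n. z m" k] l by simp
  qed
  moreover have "(\<lambda>n. seminorm G k ((\<Sum>m<n. z m) - l) + suminf c) \<longlonglongrightarrow> 0 + suminf c"
    using l by (intro tendsto_add tendsto_const) auto
  ultimately show ?thesis
    using LIMSEQ_le_const by fastforce
qed

end

section \<open>Koethe sequence spaces\<close>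

definition unit_seq :: "nat \<Rightarrow> nat \<Rightarrow> 'k::real_normed_field" where
  "unit_seq i j = (if j = i then 1 else 0)"

lemma sum_seq_apply: "(\<Sum>i\<in>I. f i :: nat \<Rightarrow> 'k::comm_monoid_add) j = (\<Sum>i\<in>I. f i j)"
  by (induction I rule: infinite_finite_induct) auto

lemma koethe_matrixD:
  assumes "koethe_matrix a"
  shows "0 \<le> a n k" "a n k \<le> a n (Suc k)" "\<exists>k. 0 < a n k"
  using assms by (auto simp: koethe_matrix_def)

lemma koethe_matrix_mono: "koethe_matrix a \<Longrightarrow> k \<le> l \<Longrightarrow> a n k \<le> a n l"
  by (rule lift_Suc_mono_le[of "a n"]) (auto dest: koethe_matrixD)

lemma vector_space_sequences: "vector_space (\<lambda>c (x :: nat \<Rightarrow> 'k::field) j. c * x j)"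
  by unfold_locales (auto simp: fun_eq_iff algebra_simps)

lemma koethe_l1_simps [simp]:
  "x \<in> points (koethe_l1 a) \<longleftrightarrow> (\<forall>k. summable (\<lambda>j. norm (x j) * a j k))"
  "scale (koethe_l1 a) = (\<lambda>c x j. c * x j)"
  "seminorm (koethe_l1 a) k x = (\<Sum>j. norm (x j) * a j k)"
  by (simp_all add: koethe_l1_def)

lemma koethe_linf_simps [simp]:
  "x \<in> points (koethe_linf a) \<longleftrightarrow> (\<forall>k. bdd_above (range (\<lambda>j. norm (x j) * a j k)))"
  "scale (koethe_linf a) = (\<lambda>c x j. c * x j)"
  "seminorm (koethe_linf a) k x = (SUP j. norm (x j) * a j k)"
  by (simp_all add: koethe_linf_def)

lemma
  fixes x y :: "nat \<Rightarrow> 'k::real_normed_field"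
  assumes a: "koethe_matrix a" and x: "summable (\<lambda>j. norm (x j) * a j k)"
    and y: "summable (\<lambda>j. norm (y j) * a j k)"
  shows summable_koethe_add: "summable (\<lambda>j. norm (x j + y j) * a j k)"
    and suminf_koethe_add: "(\<Sum>j. norm (x j + y j) * a j k) \<le> (\<Sum>j. norm (x j) * a j k) + (\<Sum>j. norm (y j) * a j k)"
proof -
  have le: "norm (x j + y j) * a j k \<le> norm (x j) * a j k + norm (y j) * a j k" for j
    using mult_right_mono[OF norm_triangle_ineq koethe_matrixD(1)[OF a]] by (simp add: distrib_right)
  show sm: "summable (\<lambda>j. norm (x j + y j) * a j k)"
    by (rule summable_comparison_test'[OF summable_add[OF x y], of 0])
      (use le koethe_matrixD(1)[OF a] in simp)
  show "(\<Sum>j. norm (x j + y j) * a j k) \<le> (\<Sum>j. norm (x j) * a j k) + (\<Sum>j. norm (y j) * a j k)"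
    using suminf_le[OF le sm summable_add[OF x y]] by (simp add: suminf_add[OF x y])
qed

lemma graded_seminormed_koethe_l1:
  assumes a: "koethe_matrix a"
  shows "graded_seminormed_space (koethe_l1 a :: ('k::real_normed_field, nat \<Rightarrow> 'k) graded_space)"
proof -
  let ?E = "koethe_l1 a :: ('k, nat \<Rightarrow> 'k) graded_space"
  interpret vector_space "scale ?E" using vector_space_sequences by simp
  note nonneg = koethe_matrixD(1)[OF a]
  show ?thesis
  proof
    show "subspace (points ?E)"
      unfolding subspace_def
      by (auto simp: norm_mult mult.assoc intro: summable_koethe_add[OF a] summable_mult)
    show "is_seminorm_on (points ?E) (scale ?E) (seminorm ?E k)" for k
      using nonneg
      by (auto simp: is_seminorm_on_def norm_mult mult.assoc suminf_mult
          intro!: suminf_nonneg suminf_koethe_add[OF a])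
    show "seminorm ?E k x \<le> seminorm ?E (Suc k) x" if "x \<in> points ?E" for k x
      using that by (auto intro!: suminf_le mult_left_mono koethe_matrixD[OF a])
  qed
qed

lemma koethe_l1_component:
  assumes "koethe_matrix a" "x \<in> points (koethe_l1 a)"
  shows "norm (x i) * a i k \<le> seminorm (koethe_l1 a) k x"
  using sum_le_suminf[of "\<lambda>j. norm (x j) * a j k" "{i}"] assms koethe_matrixD(1)[OF assms(1)] by auto

lemma unit_seq_koethe_l1 [simp]:
  "(unit_seq i :: nat \<Rightarrow> 'k::real_normed_field) \<in> points (koethe_l1 a)"
  "seminorm (koethe_l1 a) k (unit_seq i :: nat \<Rightarrow> 'k) = a i k"
proof -
  have *: "(\<lambda>j. norm (unit_seq i j :: 'k) * a j k) = (\<lambda>j. if j = i then a i k else 0)" for k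
    by (auto simp: unit_seq_def)
  have "(\<lambda>j. norm (unit_seq i j :: 'k) * a j k) sums a i k" for k
    unfolding * using sums_single[of i "\<lambda>_. a i k"] by simp
  then show "(unit_seq i :: nat \<Rightarrow> 'k) \<in> points (koethe_l1 a)"
    "seminorm (koethe_l1 a) k (unit_seq i :: nat \<Rightarrow> 'k) = a i k"
    by (auto simp: sums_iff)
qed

lemma koethe_linf_component:
  "x \<in> points (koethe_linf a) \<Longrightarrow> norm (x j) * a j k \<le> seminorm (koethe_linf a) k x"
  by (auto intro: cSUP_upper)

lemma koethe_linf_bound:
  "(\<And>j. norm (x j) * a j k \<le> M) \<Longrightarrow> seminorm (koethe_linf a) k x \<le> M"
  by (auto intro: cSUP_least)

lemma graded_seminormed_koethe_linf:
  assumes a: "koethe_matrix a"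
  shows "graded_seminormed_space (koethe_linf a :: ('k::real_normed_field, nat \<Rightarrow> 'k) graded_space)"
proof -
  let ?E = "koethe_linf a :: ('k, nat \<Rightarrow> 'k) graded_space"
  interpret vector_space "scale ?E" using vector_space_sequences by simp
  note nonneg = koethe_matrixD(1)[OF a]
  have sum: "norm ((x + y) j) * a j k \<le> seminorm ?E k x + seminorm ?E k y"
    if "x \<in> points ?E" "y \<in> points ?E" for x y j k
  proof -
    have "norm ((x + y) j) * a j k \<le> norm (x j) * a j k + norm (y j) * a j k"
      using mult_right_mono[OF norm_triangle_ineq nonneg] by (simp add: distrib_right)
    then show ?thesis using koethe_linf_component[OF that(1)] koethe_linf_component[OF that(2)]
      by (meson add_mono order_trans)
  qed
  have scale: "norm (scale ?E c x j) * a j k \<le> norm c * seminorm ?E k x" if "x \<in> points ?E" for c x j k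
    using mult_left_mono[OF koethe_linf_component[OF that, of j k] norm_ge_zero[of c]]
    by (simp add: norm_mult mult.assoc)
  have points: "x \<in> points ?E" if "\<And>j k. norm (x j) * a j k \<le> M k" for x M
    using that by (auto simp: bdd_above_def)
  show ?thesis
  proof
    show sub: "subspace (points ?E)"
      unfolding subspace_def using points[OF sum] points[OF scale] by (auto simp del: koethe_linf_simps(3))
    have nn: "0 \<le> seminorm ?E k x" if "x \<in> points ?E" for k x
      using koethe_linf_component[OF that, of 0 k] nonneg[of 0 k]
      by (meson mult_nonneg_nonneg norm_ge_zero order_trans)
    have le: "seminorm ?E k (scale ?E c x) \<le> norm c * seminorm ?E k x" if "x \<in> points ?E" for c x k
      by (rule koethe_linf_bound) (rule scale[OF that])
    have "seminorm ?E k (scale ?E c x) = norm c * seminorm ?E k x" if x: "x \<in> points ?E" for c x k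
    proof (cases "c = 0")
      case True
      then show ?thesis by simp
    next
      case False
      \<comment> \<open>Bounding the supremum gives only one inequality; the reverse one is
        \<open>le\<close> for the scalar \<open>inverse c\<close> and the vector
        \<open>scale ?E c x\<close>.\<close>
      have "scale ?E c x \<in> points ?E" using sub x by (rule subspace_scale)
      then have "seminorm ?E k (scale ?E (inverse c) (scale ?E c x)) \<le>
          norm (inverse c) * seminorm ?E k (scale ?E c x)" by (rule le)
      moreover have "scale ?E (inverse c) (scale ?E c x) = x" using False by (simp only: scale_scale) simp
      ultimately have "norm c * seminorm ?E k x \<le> seminorm ?E k (scale ?E c x)"
        using False unfolding norm_inverse by (simp add: field_simps del: koethe_linf_simps)
      then show ?thesis using le[OF x] by (rule antisym[rotated])
    qed
    moreover have "seminorm ?E k (x + y) \<le> seminorm ?E k x + seminorm ?E k y"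
      if "x \<in> points ?E" "y \<in> points ?E" for x y k
      by (rule koethe_linf_bound) (rule sum[OF that])
    ultimately show "is_seminorm_on (points ?E) (scale ?E) (seminorm ?E k)" for k
      unfolding is_seminorm_on_def using nn by blast
    show "seminorm ?E k x \<le> seminorm ?E (Suc k) x" if "x \<in> points ?E" for k x
      by (rule koethe_linf_bound)
        (meson koethe_linf_component[OF that] koethe_matrixD(2)[OF a] mult_left_mono norm_ge_zero order_trans)
  qed
qed

text \<open>The seminorm of the remainder is a tail of a convergent series. This density of finitely
  supported sequences lets operators be estimated from their values on unit sequences.\<close>

lemma koethe_l1_truncation:
  fixes x :: "nat \<Rightarrow> 'k::real_normed_field"
  assumes a: "koethe_matrix a" and x: "x \<in> points (koethe_l1 a)"
  shows "(\<lambda>n. seminorm (koethe_l1 a) k (x - (\<Sum>i<n. scale (koethe_l1 a) (x i) (unit_seq i)))) \<longlonglongrightarrow> 0"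
proof -
  have tr: "x - (\<Sum>i<n. scale (koethe_l1 a) (x i) (unit_seq i)) = (\<lambda>j. if j < n then 0 else x j)" for n
  proof
    fix j
    have "(\<Sum>i<n. scale (koethe_l1 a) (x i) (unit_seq i)) j = (\<Sum>i<n. if j = i then x i else 0)"
      by (simp add: sum_seq_apply unit_seq_def if_distrib cong: if_cong)
    then show "(x - (\<Sum>i<n. scale (koethe_l1 a) (x i) (unit_seq i))) j = (if j < n then 0 else x j)"
      by simp
  qed
  have sm: "summable (\<lambda>j. norm (x j) * a j k)" using x by simp
  have "(\<Sum>j. norm (if j < n then 0 else x j) * a j k) = (\<Sum>j. norm (x (j + n)) * a (j + n) k)" for n
  proof -
    have "summable (\<lambda>j. norm (if j < n then 0 else x j) * a j k)"
      by (rule summable_comparison_test'[OF sm, of 0]) (use koethe_matrixD(1)[OF a] in auto)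
    from suminf_split_initial_segment[OF this, of n] show ?thesis by simp
  qed
  moreover have "(\<lambda>n. \<Sum>j. norm (x (j + n)) * a (j + n) k) \<longlonglongrightarrow> 0"
    using suminf_exist_split2[OF sm] .
  ultimately show ?thesis unfolding tr by simp
qed

section \<open>Operators given by rapidly decreasing series of rank one operators\<close>

text \<open>
  Bounded coefficient sequences are sampled at the integers from bounded continuous functions on the
  reals, because functions on \<^typ>\<open>nat\<close> are not an instance of \<^class>\<open>complete_space\<close>.
\<close>

definition unit_bcontfun :: "nat \<Rightarrow> real \<Rightarrow>\<^sub>C 'k::real_normed_field" where
  "unit_bcontfun m = Bcontfun (\<lambda>x. of_real (max 0 (1 - \<bar>x - real m\<bar>)))"

lemma apply_unit_bcontfun:
  "apply_bcontfun (unit_bcontfun m :: real \<Rightarrow>\<^sub>C 'k::real_normed_field) x = of_real (max 0 (1 - \<bar>x - real m\<bar>))"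
proof -
  have "(\<lambda>x. of_real (max 0 (1 - \<bar>x - real m\<bar>)) :: 'k) \<in> bcontfun"
    by (rule bcontfun_normI[of _ 1]) (auto intro!: continuous_intros simp: norm_of_real)
  then show ?thesis by (simp add: unit_bcontfun_def Bcontfun_inverse)
qed

text \<open>The tent around \<open>m\<close> has half-width 1, so it vanishes at every other
  integer.\<close>

lemma apply_unit_bcontfun_nat [simp]: "apply_bcontfun (unit_bcontfun m) (real n) = unit_seq m n"
proof -
  have "1 \<le> \<bar>real n - real m\<bar>" if "n \<noteq> m" using that by linarith
  then show ?thesis by (auto simp: apply_unit_bcontfun unit_seq_def)
qed

lemma norm_unit_bcontfun_le: "norm (unit_bcontfun m :: real \<Rightarrow>\<^sub>C 'k::real_normed_field) \<le> 1"
  by (rule norm_bound) (simp add: apply_unit_bcontfun norm_of_real)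

lemma factorable_compose:
  fixes E :: "('k::real_normed_field, 'u::ab_group_add) graded_space"
    and G :: "('k, 'v::ab_group_add) graded_space"
    and F :: "('k, 'w::ab_group_add) graded_space"
  assumes sp: "graded_seminormed_space E" "graded_seminormed_space G"
    and Q: "Q \<in> operators E G" and R: "R \<in> operators G F"
  shows "(\<lambda>x. R (Q x)) \<in> factorable_operators E G F"
proof -
  have "Q ` points E \<subseteq> points G" using Q operators_iff[OF sp] by blast
  then have "linear_on (points E) (scale E) (scale F) (\<lambda>x. R (Q x))"
    using Q R unfolding operators_def linear_on_def by (simp add: image_subset_iff)
  moreover have "continuous_map (graded_topology E) (graded_topology F) (\<lambda>x. R (Q x))"
    using Q R continuous_map_compose[of _ _ Q _ R] by (auto simp: operators_def comp_def)
  ultimately have "(\<lambda>x. R (Q x)) \<in> operators E F" by (simp add: operators_def)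
  then show ?thesis using Q R by (auto simp: factorable_operators_def)
qed

text \<open>The constants depend on \<open>q\<close> but not on \<open>m\<close>. The factor
  \<open>(1/2)^m\<close> makes the series for both operators converge absolutely for all bounded
  coefficients, with a loss of index given by \<open>\<phi>\<close> in each.\<close>

locale rank_one_series = frechet_space G
  for G :: "('k::{real_normed_field, banach}, 'g::ab_group_add) graded_space" +
  fixes A C :: "nat \<Rightarrow> nat \<Rightarrow> real" and \<phi> :: "nat \<Rightarrow> nat"
    and y :: "nat \<Rightarrow> 'g" and i :: "nat \<Rightarrow> nat" and y' :: "nat \<Rightarrow> 'g \<Rightarrow> 'k" and j :: "nat \<Rightarrow> nat"
  assumes A: "koethe_matrix A" and C: "koethe_matrix C"
    and y: "\<And>m. y m \<in> points G"
    and y_bound: "\<And>q. \<exists>M\<ge>0. \<forall>m. seminorm G q (y m) \<le> M * A (i m) (\<phi> q) * (1/2)^m"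
    and y': "\<And>m. linear_on (points G) (scale G) (*) (y' m)"
    and y'_bound: "\<And>q. \<exists>M\<ge>0. \<forall>m. \<forall>x\<in>points G.
      norm (y' m x) * C (j m) q \<le> M * seminorm G (\<phi> q) x * (1/2)^m"
begin

abbreviation EA :: "('k, nat \<Rightarrow> 'k) graded_space" where "EA \<equiv> koethe_l1 A"
abbreviation FC :: "('k, nat \<Rightarrow> 'k) graded_space" where "FC \<equiv> koethe_linf C"

sublocale EA: graded_seminormed_space EA by (rule graded_seminormed_koethe_l1[OF A])
sublocale FC: graded_seminormed_space FC by (rule graded_seminormed_koethe_linf[OF C])

definition Q_term :: "(real \<Rightarrow>\<^sub>C 'k) \<Rightarrow> (nat \<Rightarrow> 'k) \<Rightarrow> nat \<Rightarrow> 'g" where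
  "Q_term s x m = scale G (apply_bcontfun s (real m) * x (i m)) (y m)"

definition Q :: "(real \<Rightarrow>\<^sub>C 'k) \<Rightarrow> (nat \<Rightarrow> 'k) \<Rightarrow> 'g" where
  "Q s x = graded_suminf G (Q_term s x)"

text \<open>Different \<open>m\<close> may share the same \<open>j m\<close>, so the contributions
  to coordinate \<open>n\<close> are collected over all \<open>m\<close> with
  \<open>j m = n\<close>.\<close>

definition R_term :: "(real \<Rightarrow>\<^sub>C 'k) \<Rightarrow> 'g \<Rightarrow> nat \<Rightarrow> nat \<Rightarrow> 'k" where
  "R_term t w n m = (if j m = n then apply_bcontfun t (real m) * y' m w else 0)"

definition R :: "(real \<Rightarrow>\<^sub>C 'k) \<Rightarrow> 'g \<Rightarrow> nat \<Rightarrow> 'k" where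
  "R t w n = (\<Sum>m. R_term t w n m)"

section \<open>Convergence, bounds and linearity of \<open>Q\<close>\<close>

lemma sums_half: "(\<lambda>m. c * (1/2::real)^m) sums (2 * c)"
  using sums_mult[OF geometric_sums[of "1/2::real"], of c] by (simp add: mult.commute)

text \<open>The weight \<open>A (i m) (\<phi> q)\<close> coming from \<open>y_bound\<close> is
  absorbed by the single coordinate \<open>x (i m)\<close>, which leaves a geometric series.\<close>

lemma Q_term_bound:
  "\<exists>M\<ge>0. \<forall>s. \<forall>x\<in>points EA. \<forall>m. seminorm G q (Q_term s x m) \<le> M * norm s * seminorm EA (\<phi> q) x * (1/2)^m"
proof -
  obtain M where M: "0 \<le> M" "\<And>m. seminorm G q (y m) \<le> M * A (i m) (\<phi> q) * (1/2)^m"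
    using y_bound by blast
  have "seminorm G q (Q_term s x m) \<le> M * norm s * seminorm EA (\<phi> q) x * (1/2)^m"
    if x: "x \<in> points EA" for s x m
  proof -
    have "seminorm G q (Q_term s x m) = norm (apply_bcontfun s (real m)) * (norm (x (i m)) * seminorm G q (y m))"
      using y by (simp add: Q_term_def seminorm_scale norm_mult)
    also have "\<dots> \<le> norm s * (norm (x (i m)) * (M * A (i m) (\<phi> q) * (1/2)^m))"
      by (intro mult_mono norm_bounded M) (auto simp: y)
    also have "\<dots> = (M * norm s * (1/2)^m) * (norm (x (i m)) * A (i m) (\<phi> q))" by simp
    also have "\<dots> \<le> (M * norm s * (1/2)^m) * seminorm EA (\<phi> q) x"
      using M x by (intro mult_left_mono koethe_l1_component A) auto
    finally show ?thesis by (simp add: mult_ac)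
  qed
  then show ?thesis using M(1) by blast
qed

lemma Q_sums:
  assumes x: "x \<in> points EA"
  shows "graded_sums G (Q_term s x) (Q s x)"
  unfolding Q_def
proof (rule graded_sums_suminf)
  show pts: "Q_term s x m \<in> points G" for m using y by (simp add: Q_term_def)
  fix q
  obtain M where "\<And>m. seminorm G q (Q_term s x m) \<le> M * norm s * seminorm EA (\<phi> q) x * (1/2)^m"
    using Q_term_bound[of q] x by blast
  then show "summable (\<lambda>m. seminorm G q (Q_term s x m))"
    by (intro summable_comparison_test'[OF sums_summable[OF sums_half]]) (simp add: pts)
qed

lemma Q_points: "x \<in> points EA \<Longrightarrow> Q s x \<in> points G"
  using Q_sums by (auto simp: graded_sums_def)

lemma Q_bound: "\<exists>M\<ge>0. \<forall>s. \<forall>x\<in>points EA. seminorm G q (Q s x) \<le> M * norm s * seminorm EA (\<phi> q) x"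
proof -
  obtain M where M: "0 \<le> M"
    "\<And>s x m. x \<in> points EA \<Longrightarrow> seminorm G q (Q_term s x m) \<le> M * norm s * seminorm EA (\<phi> q) x * (1/2)^m"
    using Q_term_bound[of q] by blast
  have "seminorm G q (Q s x) \<le> 2 * M * norm s * seminorm EA (\<phi> q) x" if "x \<in> points EA" for s x
    using graded_sums_seminorm_le[OF Q_sums[OF that] sums_summable[OF sums_half] M(2)[OF that], of s]
    unfolding sums_unique[OF sums_half, symmetric] by (simp add: mult.assoc del: koethe_l1_simps)
  then show ?thesis using M(1) by (intro exI[of _ "2 * M"]) auto
qed

text \<open>Reduces the algebraic identities for \<open>Q\<close> to identities between the terms of
  the series.\<close>

lemma Q_eqI: "x \<in> points EA \<Longrightarrow> graded_sums G (Q_term s x) l \<Longrightarrow> Q s x = l"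
  using Q_sums graded_sums_unique by blast

lemma Q_add_right:
  assumes "x \<in> points EA" "x' \<in> points EA"
  shows "Q s (x + x') = Q s x + Q s x'"
proof (rule Q_eqI)
  have "Q_term s (x + x') = (\<lambda>m. Q_term s x m + Q_term s x' m)"
    by (simp add: Q_term_def fun_eq_iff distrib_left scale_left_distrib)
  then show "graded_sums G (Q_term s (x + x')) (Q s x + Q s x')"
    using graded_sums_add[OF Q_sums Q_sums] assms by metis
qed (use assms in blast)

lemma Q_scale_right:
  assumes "x \<in> points EA"
  shows "Q s (scale EA c x) = scale G c (Q s x)"
proof (rule Q_eqI)
  have "Q_term s (scale EA c x) = (\<lambda>m. scale G c (Q_term s x m))"
    by (simp add: Q_term_def fun_eq_iff mult_ac)
  then show "graded_sums G (Q_term s (scale EA c x)) (scale G c (Q s x))"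
    using graded_sums_scale[OF Q_sums] assms by metis
qed (use assms in blast)

lemma Q_add_left:
  assumes "x \<in> points EA"
  shows "Q (s + s') x = Q s x + Q s' x"
proof (rule Q_eqI)
  have "Q_term (s + s') x = (\<lambda>m. Q_term s x m + Q_term s' x m)"
    by (simp add: Q_term_def fun_eq_iff distrib_right scale_left_distrib)
  then show "graded_sums G (Q_term (s + s') x) (Q s x + Q s' x)"
    using graded_sums_add[OF Q_sums Q_sums] assms by metis
qed (rule assms)

lemma Q_scaleR_left:
  assumes "x \<in> points EA"
  shows "Q (r *\<^sub>R s) x = scale G (of_real r) (Q s x)"
proof (rule Q_eqI)
  have "Q_term (r *\<^sub>R s) x = (\<lambda>m. scale G (of_real r) (Q_term s x m))"
    by (simp add: Q_term_def fun_eq_iff scaleR_conv_of_real mult_ac)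
  then show "graded_sums G (Q_term (r *\<^sub>R s) x) (scale G (of_real r) (Q s x))"
    using graded_sums_scale[OF Q_sums] assms by metis
qed (rule assms)

lemma Q_operator: "Q s \<in> operators EA G"
proof -
  have "\<exists>r M. 0 \<le> M \<and> (\<forall>x\<in>points EA. seminorm G k (Q s x) \<le> M * seminorm EA r x)" for k
    using Q_bound[of k] by (metis mult_nonneg_nonneg norm_ge_zero)
  then show ?thesis
    unfolding operators_iff[OF EA.graded_seminormed_space_axioms graded_seminormed_space_axioms] linear_on_def
    using Q_add_right Q_scale_right Q_points by blast
qed

text \<open>The tent coefficient keeps only the term of index \<open>m\<close>, even if other
  indices have the same value of \<open>i\<close>. Together with \<open>R_unit\<close> this recovers
  \<open>y' m (y m)\<close> as a matrix entry.\<close>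

lemma Q_unit: "Q (unit_bcontfun m) (unit_seq (i m)) = y m"
proof (rule Q_eqI)
  have "Q_term (unit_bcontfun m) (unit_seq (i m)) m = y m" by (simp add: Q_term_def unit_seq_def)
  then show "graded_sums G (Q_term (unit_bcontfun m) (unit_seq (i m))) (y m)"
    using graded_sums_single[of m "Q_term (unit_bcontfun m) (unit_seq (i m))"] y
    by (simp add: Q_term_def unit_seq_def)
qed (rule unit_seq_koethe_l1)

section \<open>Convergence, bounds and linearity of \<open>R\<close>\<close>

lemma R_term_bound:
  "\<exists>M\<ge>0. \<forall>t. \<forall>w\<in>points G. \<forall>n m. norm (R_term t w n m) * C n q \<le> M * norm t * seminorm G (\<phi> q) w * (1/2)^m"
proof -
  obtain M where M: "0 \<le> M"
    "\<And>m x. x \<in> points G \<Longrightarrow> norm (y' m x) * C (j m) q \<le> M * seminorm G (\<phi> q) x * (1/2)^m"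
    using y'_bound by blast
  have "norm (R_term t w n m) * C n q \<le> M * norm t * seminorm G (\<phi> q) w * (1/2)^m"
    if w: "w \<in> points G" for t w n m
  proof (cases "j m = n")
    case True
    then have "norm (R_term t w n m) * C n q = norm (apply_bcontfun t (real m)) * (norm (y' m w) * C (j m) q)"
      by (simp add: R_term_def norm_mult)
    also have "\<dots> \<le> norm t * (M * seminorm G (\<phi> q) w * (1/2)^m)"
      by (intro mult_mono norm_bounded M w) (auto simp: koethe_matrixD[OF C])
    finally show ?thesis by (simp add: mult_ac)
  next
    case False
    then show ?thesis using M(1) w by (simp add: R_term_def)
  qed
  then show ?thesis using M(1) by blast
qed

text \<open>Every coordinate has positive weight \<open>C n q\<close> for some \<open>q\<close>, and
  dividing the weighted bound by it gives absolute convergence.\<close>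

lemma R_summable:
  assumes w: "w \<in> points G"
  shows "summable (\<lambda>m. norm (R_term t w n m))"
proof -
  obtain q where q: "0 < C n q" using koethe_matrixD(3)[OF C] by blast
  obtain M where "\<And>m. norm (R_term t w n m) * C n q \<le> M * norm t * seminorm G (\<phi> q) w * (1/2)^m"
    using R_term_bound[of q] w by blast
  then have "norm (norm (R_term t w n m)) \<le> M * norm t * seminorm G (\<phi> q) w / C n q * (1/2)^m" for m
    using q by (simp add: pos_le_divide_eq)
  then show ?thesis
    by (rule summable_comparison_test'[OF sums_summable[OF sums_half]])
qed

lemma R_bound: "\<exists>M\<ge>0. \<forall>t. \<forall>w\<in>points G. \<forall>n. norm (R t w n) * C n q \<le> M * norm t * seminorm G (\<phi> q) w"
proof -
  obtain M where M: "0 \<le> M"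
    "\<And>t w n m. w \<in> points G \<Longrightarrow> norm (R_term t w n m) * C n q \<le> M * norm t * seminorm G (\<phi> q) w * (1/2)^m"
    using R_term_bound[of q] by blast
  have "norm (R t w n) * C n q \<le> 2 * M * norm t * seminorm G (\<phi> q) w" if w: "w \<in> points G" for t w n
  proof -
    have "norm (R t w n) * C n q \<le> (\<Sum>m. norm (R_term t w n m)) * C n q"
      unfolding R_def by (intro mult_right_mono summable_norm R_summable w koethe_matrixD C)
    also have "\<dots> = (\<Sum>m. norm (R_term t w n m) * C n q)"
      by (rule suminf_mult2[OF R_summable[OF w]])
    also have "\<dots> \<le> (\<Sum>m. M * norm t * seminorm G (\<phi> q) w * (1/2)^m)"
      by (intro suminf_le M w summable_mult2 R_summable sums_summable[OF sums_half])
    finally show ?thesis unfolding sums_unique[OF sums_half, symmetric] by (simp add: mult.assoc)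
  qed
  then show ?thesis using M(1) by (intro exI[of _ "2 * M"]) auto
qed

lemma R_add_right:
  assumes "w \<in> points G" "w' \<in> points G"
  shows "R t (w + w') = R t w + R t w'"
proof
  fix n
  have "R_term t (w + w') n = (\<lambda>m. R_term t w n m + R_term t w' n m)"
    using y' assms by (simp add: R_term_def fun_eq_iff linear_on_def distrib_left)
  then show "R t (w + w') n = (R t w + R t w') n"
    using suminf_add[OF summable_norm_cancel[OF R_summable] summable_norm_cancel[OF R_summable]] assms
    by (simp add: R_def)
qed

lemma R_scale_right:
  assumes "w \<in> points G"
  shows "R t (scale G c w) = scale FC c (R t w)"
proof
  fix n
  have "R_term t (scale G c w) n = (\<lambda>m. c * R_term t w n m)"
    using y' assms by (simp add: R_term_def fun_eq_iff linear_on_def)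
  then show "R t (scale G c w) n = scale FC c (R t w) n"
    using suminf_mult[OF summable_norm_cancel[OF R_summable]] assms by (simp add: R_def)
qed

lemma R_add_left:
  assumes "w \<in> points G"
  shows "R (t + t') w = R t w + R t' w"
proof
  fix n
  have "R_term (t + t') w n = (\<lambda>m. R_term t w n m + R_term t' w n m)"
    by (simp add: R_term_def fun_eq_iff distrib_right)
  then show "R (t + t') w n = (R t w + R t' w) n"
    using suminf_add[OF summable_norm_cancel[OF R_summable] summable_norm_cancel[OF R_summable]] assms
    by (simp add: R_def)
qed

lemma R_scaleR_left:
  assumes "w \<in> points G"
  shows "R (r *\<^sub>R t) w n = r *\<^sub>R R t w n"
proof -
  have "R_term (r *\<^sub>R t) w n = (\<lambda>m. r *\<^sub>R R_term t w n m)"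
    by (simp add: R_term_def fun_eq_iff)
  then show ?thesis
    using suminf_scaleR_right[OF summable_norm_cancel[OF R_summable]] assms by (simp add: R_def)
qed

lemma R_operator: "R t \<in> operators G FC"
proof -
  have bound: "\<exists>M\<ge>0. \<forall>w\<in>points G. \<forall>n. norm (R t w n) * C n k \<le> M * seminorm G (\<phi> k) w" for k
    using R_bound[of k] by (metis mult_nonneg_nonneg norm_ge_zero)
  then have "R t w \<in> points FC" if "w \<in> points G" for w
    using that by (fastforce simp: bdd_above_def)
  moreover have "\<exists>r M. 0 \<le> M \<and> (\<forall>w\<in>points G. seminorm FC k (R t w) \<le> M * seminorm G r w)" for k
    using bound[of k] koethe_linf_bound by blast
  ultimately show ?thesis
    unfolding operators_iff[OF graded_seminormed_space_axioms FC.graded_seminormed_space_axioms] linear_on_def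
    using R_add_right R_scale_right by blast
qed

lemma R_unit: "R (unit_bcontfun m) w (j m) = y' m w"
proof -
  have "R_term (unit_bcontfun m) w (j m) = (\<lambda>n. if n = m then y' m w else 0)"
    by (auto simp: R_term_def unit_seq_def fun_eq_iff)
  then show ?thesis
    using sums_single[of m "\<lambda>_. y' m w"] by (simp add: R_def sums_iff)
qed

section \<open>Matrix entries of the products and uniform tameness\<close>

text \<open>A positive weight \<open>C n q\<close> converts \<open>R_bound\<close> into a bound for
  coordinate \<open>n\<close>; inserting \<open>Q_bound\<close> at index \<open>\<phi> q\<close>
  produces the doubly shifted index \<open>\<phi> (\<phi> q)\<close>. The constant may depend on
  \<open>e\<close> and \<open>n\<close>.\<close>

lemma bounded_bilinear_RQ: "bounded_bilinear (\<lambda>s t. R t (Q s (unit_seq e)) n)"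
proof
  obtain q where q: "0 < C n q" using koethe_matrixD(3)[OF C] by blast
  obtain M where M: "0 \<le> M" "\<And>t w. w \<in> points G \<Longrightarrow> norm (R t w n) * C n q \<le> M * norm t * seminorm G (\<phi> q) w"
    using R_bound[of q] by blast
  obtain N where N: "0 \<le> N" "\<And>s x. x \<in> points EA \<Longrightarrow> seminorm G (\<phi> q) (Q s x) \<le> N * norm s * seminorm EA (\<phi> (\<phi> q)) x"
    using Q_bound[of "\<phi> q"] by blast
  have "norm (R t (Q s (unit_seq e)) n) \<le> norm s * norm t * (M * N * A e (\<phi> (\<phi> q)) / C n q)" for s t
  proof -
    have "norm (R t (Q s (unit_seq e)) n) * C n q \<le> M * norm t * seminorm G (\<phi> q) (Q s (unit_seq e))"
      by (rule M(2)) (rule Q_points[OF unit_seq_koethe_l1(1)])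
    also have "\<dots> \<le> M * norm t * (N * norm s * A e (\<phi> (\<phi> q)))"
      using N(2)[OF unit_seq_koethe_l1(1), of s e] M(1) unfolding unit_seq_koethe_l1(2)
      by (intro mult_left_mono) auto
    finally show ?thesis using q by (simp add: field_simps)
  qed
  then show "\<exists>K. \<forall>s t. norm (R t (Q s (unit_seq e)) n) \<le> norm s * norm t * K" by blast
qed (use R_scale_right in \<open>simp_all add: Q_add_left R_add_left R_add_right Q_points Q_scaleR_left R_scaleR_left scaleR_conv_of_real
      del: koethe_l1_simps(1)\<close>)

text \<open>Tameness of each product bounds its matrix, entry \<open>(e, n)\<close> being weighted
  by \<open>C n k\<close> and \<open>A e (S k)\<close>. The Baire argument makes the bound uniform
  in both coefficient functions, and tents at \<open>m\<close> then single out
  \<open>y' m (y m)\<close> in entry \<open>(i m, j m)\<close>.\<close>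

lemma tame_imp_uniform_bound:
  assumes tame: "\<And>T. T \<in> factorable_operators EA G FC \<Longrightarrow> \<exists>k0. \<forall>k\<ge>k0. continuity_index EA FC T k \<le> enat (S k)"
  shows "\<exists>k0. \<forall>k\<ge>k0. \<exists>M\<ge>0. \<forall>m. C (j m) k * norm (y' m (y m)) \<le> M * A (i m) (S k)"
proof -
  define b where "b = (\<lambda>(e, n) s t. R t (Q s (unit_seq e)) n)"
  have "\<exists>k0. \<forall>k\<ge>k0. \<exists>M\<ge>0. \<forall>l s t.
      C (snd l) k * norm (b l s t) \<le> M * norm s * norm t * A (fst l) (S k)"
  proof (rule eventually_bounded_bilinear_family[where b = b and c = "\<lambda>k l. C (snd l) k"
        and a = "\<lambda>k l. A (fst l) (S k)"])
    show "bounded_bilinear (b l)" for l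
      using bounded_bilinear_RQ by (cases l) (simp add: b_def)
    show "0 \<le> C (snd l) k" "0 \<le> A (fst l) (S k)" for l k
      using koethe_matrixD(1) A C by auto
    fix s t
    let ?T = "\<lambda>x. R t (Q s x)"
    have T: "?T \<in> factorable_operators EA G FC"
      by (rule factorable_compose[OF EA.graded_seminormed_space_axioms graded_seminormed_space_axioms
            Q_operator R_operator])
    then have op: "?T \<in> operators EA FC" by (simp add: factorable_operators_def)
    obtain k0 where k0: "\<And>k. k \<ge> k0 \<Longrightarrow> continuity_index EA FC ?T k \<le> enat (S k)"
      using tame[OF T] by blast
    have "\<exists>M. \<forall>l. C (snd l) k * norm (b l s t) \<le> M * A (fst l) (S k)" if k: "k \<ge> k0" for k
    proof -
      obtain M where M: "\<And>x. x \<in> points EA \<Longrightarrow> seminorm FC k (?T x) \<le> M * seminorm EA (S k) x"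
        using k0[OF k] unfolding continuity_index_le_iff[OF EA.graded_seminormed_space_axioms
            FC.graded_seminormed_space_axioms op] by blast
      have "C n k * norm (?T (unit_seq e) n) \<le> M * A e (S k)" for e n
      proof -
        have "?T (unit_seq e) \<in> points FC"
          using R_operator Q_operator unit_seq_koethe_l1(1)[of e A]
          unfolding operators_iff[OF graded_seminormed_space_axioms FC.graded_seminormed_space_axioms]
          using Q_points by blast
        from koethe_linf_component[OF this, of n k] M[OF unit_seq_koethe_l1(1), of e]
        show ?thesis unfolding unit_seq_koethe_l1(2) by (simp add: mult.commute del: koethe_linf_simps)
      qed
      then show ?thesis by (intro exI[of _ M]) (auto simp: b_def)
    qed
    then show "\<exists>k0. \<forall>k\<ge>k0. \<exists>M. \<forall>l. C (snd l) k * norm (b l s t) \<le> M * A (fst l) (S k)" by blast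
  qed
  then obtain k0 where k0: "\<And>k. k \<ge> k0 \<Longrightarrow> \<exists>M\<ge>0. \<forall>l s t.
      C (snd l) k * norm (b l s t) \<le> M * norm s * norm t * A (fst l) (S k)" by blast
  have "\<exists>M\<ge>0. \<forall>m. C (j m) k * norm (y' m (y m)) \<le> M * A (i m) (S k)" if k: "k \<ge> k0" for k
  proof -
    obtain M where M: "0 \<le> M" "\<And>l s t. C (snd l) k * norm (b l s t) \<le> M * norm s * norm t * A (fst l) (S k)"
      using k0[OF k] by blast
    have "C (j m) k * norm (y' m (y m)) \<le> M * A (i m) (S k)" for m
    proof -
      let ?u = "unit_bcontfun m :: real \<Rightarrow>\<^sub>C 'k"
      have "C (j m) k * norm (y' m (y m)) \<le> M * norm ?u * norm ?u * A (i m) (S k)"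
        using M(2)[of "(i m, j m)" ?u ?u] by (simp add: b_def Q_unit R_unit)
      \<comment> \<open>Tents have norm at most 1, which keeps the constant independent of
        \<open>m\<close>.\<close>
      also have "\<dots> \<le> M * 1 * 1 * A (i m) (S k)"
        using M(1) koethe_matrixD(1)[OF A] norm_unit_bcontfun_le[of m]
        by (intro mult_right_mono mult_mono) auto
      finally show ?thesis by simp
    qed
    then show ?thesis using M(1) by blast
  qed
  then show ?thesis by blast
qed

end

section \<open>Tame factorization\<close>

text \<open>For \<open>a = 0\<close> the quotient is infinite unless \<open>s = 0\<close>, so both
  sides then say \<open>s = 0\<close>; the conventions for zero denominators thus match the real
  inequality.\<close>

lemma ennreal_divide_le_iff:
  assumes "0 \<le> s" "0 \<le> a" "0 \<le> p"
  shows "ennreal s / ennreal a \<le> ennreal p \<longleftrightarrow> s \<le> p * a"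
proof (cases "a = 0")
  case True
  then show ?thesis using assms by (auto simp: top_unique)
next
  case False
  then show ?thesis using assms by (simp add: divide_ennreal pos_divide_le_eq)
qed

lemma ennreal_divide_mult_le_iff:
  assumes "0 \<le> c" "0 \<le> a" "0 \<le> z" "0 \<le> M"
  shows "ennreal c / ennreal a * ennreal z \<le> ennreal M \<longleftrightarrow> c * z \<le> M * a"
proof -
  have "ennreal c / ennreal a * ennreal z = ennreal (c * z) / ennreal a"
    using assms by (simp add: divide_ennreal_def ennreal_mult mult_ac)
  then show ?thesis using assms by (simp add: ennreal_divide_le_iff)
qed

lemma max_mult_le:
  assumes "u \<le> ennreal p" "v \<le> ennreal n" "0 \<le> p" "0 \<le> n"
  shows "max_mult u v \<le> ennreal (p * n)"
proof -
  have "u \<noteq> \<infinity>" "v \<noteq> \<infinity>" using assms by (auto simp: top_unique)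
  then show ?thesis using assms mult_mono[OF assms(1,2)] by (simp add: max_mult_def ennreal_mult)
qed

text \<open>The estimate is quantified over nondecreasing \<open>\<phi>\<close>, while the
  continuity indices of two given operators come in no particular order; cumulative sums repair
  this.\<close>

lemma mono_common_bound:
  fixes f g :: "nat \<Rightarrow> nat"
  obtains \<phi> where "mono \<phi>" "\<And>q. f q \<le> \<phi> q" "\<And>q. g q \<le> \<phi> q"
proof
  let ?\<phi> = "\<lambda>q. \<Sum>p\<le>q. f p + g p"
  show "mono ?\<phi>" by (intro monoI sum_mono2) auto
  have "f q + g q \<le> ?\<phi> q" for q by (rule member_le_sum) auto
  then show "f q \<le> ?\<phi> q" "g q \<le> ?\<phi> q" for q by (meson add_leE)+
qed

text \<open>Only the finitely many \<open>m < q\<close> escape \<open>le\<close>. Their constants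
  are added up, and the summand 1 takes care of all other \<open>m\<close>.\<close>

lemma uniform_bound_finite_exceptions:
  fixes f g :: "nat \<Rightarrow> 'b \<Rightarrow> real"
  assumes g: "\<And>m x. x \<in> X \<Longrightarrow> 0 \<le> g m x"
    and ex: "\<And>m. \<exists>M\<ge>0. \<forall>x\<in>X. f m x \<le> M * g m x"
    and le: "\<And>m x. q \<le> m \<Longrightarrow> x \<in> X \<Longrightarrow> f m x \<le> g m x"
  shows "\<exists>M\<ge>0. \<forall>m. \<forall>x\<in>X. f m x \<le> M * g m x"
proof -
  obtain M where M: "\<And>m. 0 \<le> M m" "\<And>m x. x \<in> X \<Longrightarrow> f m x \<le> M m * g m x"
    using ex by metis
  let ?N = "1 + (\<Sum>m<q. M m)"
  have N: "1 \<le> ?N" using M(1) by (simp add: sum_nonneg)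
  have "f m x \<le> ?N * g m x" if x: "x \<in> X" for m x
  proof (cases "q \<le> m")
    case True
    then show ?thesis using le[OF True x] mult_right_mono[OF N g[OF x, of m]] by simp
  next
    case False
    then have "M m \<le> ?N" using member_le_sum[of m "{..<q}" M] M(1) by fastforce
    then show ?thesis using M(2)[OF x, of m] mult_right_mono[OF _ g[OF x, of m]] order_trans by blast
  qed
  then show ?thesis using N by (intro exI[of _ ?N]) auto
qed

text \<open>On truncations of \<open>x\<close> the triangle inequality and the matrix bound give the
  claim. The remainder is controlled by some continuity estimate with unknown index \<open>r\<close>
  and constant \<open>D\<close>, which disappear in the limit.\<close>

lemma koethe_operator_bound:
  fixes A C :: "nat \<Rightarrow> nat \<Rightarrow> real"
    and T :: "(nat \<Rightarrow> 'k::real_normed_field) \<Rightarrow> nat \<Rightarrow> 'k"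
  assumes A: "koethe_matrix A" and C: "koethe_matrix C"
    and T: "T \<in> operators (koethe_l1 A) (koethe_linf C)" and "0 \<le> M"
    and unit: "\<And>i j. norm (T (unit_seq i) j) * C j k \<le> M * A i s"
    and x: "x \<in> points (koethe_l1 A)"
  shows "seminorm (koethe_linf C) k (T x) \<le> M * seminorm (koethe_l1 A) s x"
proof (rule koethe_linf_bound)
  fix j
  let ?E = "koethe_l1 A :: ('k, nat \<Rightarrow> 'k) graded_space"
  let ?F = "koethe_linf C :: ('k, nat \<Rightarrow> 'k) graded_space"
  interpret E: graded_seminormed_space ?E by (rule graded_seminormed_koethe_l1[OF A])
  interpret F: graded_seminormed_space ?F by (rule graded_seminormed_koethe_linf[OF C])
  have lin: "linear_on (points ?E) (scale ?E) (scale ?F) T" and img: "T ` points ?E \<subseteq> points ?F"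
    and cont: "\<exists>r D. 0 \<le> D \<and> (\<forall>x\<in>points ?E. seminorm ?F k (T x) \<le> D * seminorm ?E r x)"
    using T unfolding operators_iff[OF E.graded_seminormed_space_axioms F.graded_seminormed_space_axioms]
    by blast+
  obtain r D where D: "\<And>x. x \<in> points ?E \<Longrightarrow> seminorm ?F k (T x) \<le> D * seminorm ?E r x"
    using cont by blast
  define X where "X n = (\<Sum>i<n. scale ?E (x i) (unit_seq i))" for n
  have X: "X n \<in> points ?E" for n
    unfolding X_def by (intro E.points_sum E.points_closed(5) unit_seq_koethe_l1(1))
  have TX: "T (X n) j = (\<Sum>i<n. x i * T (unit_seq i) j)" for n
  proof (induction n)
    case 0
    have "T 0 = 0"
      by (rule linear_on_zero[OF E.graded_seminormed_space_axioms F.graded_seminormed_space_axioms lin])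
    moreover have "X 0 = 0" by (simp only: X_def lessThan_0 sum.empty)
    ultimately have "T (X 0) = 0" by (simp only:)
    then show ?case by simp
  next
    case (Suc n)
    have "T (X n + scale ?E (x n) (unit_seq n)) = T (X n) + scale ?F (x n) (T (unit_seq n))"
      using lin X[of n] unit_seq_koethe_l1(1)[of n A] E.points_closed(5)[OF unit_seq_koethe_l1(1)]
      unfolding linear_on_def by metis
    moreover have "X (Suc n) = X n + scale ?E (x n) (unit_seq n)"
      by (simp only: X_def sum.lessThan_Suc)
    ultimately have "T (X (Suc n)) = T (X n) + scale ?F (x n) (T (unit_seq n))" by (simp only:)
    then show ?case using Suc by simp
  qed
  have "norm (T x j) * C j k \<le> D * seminorm ?E r (x - X n) + M * seminorm ?E s x" for n
  proof -
    have "T x = T (x - X n) + T (X n)"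
      using linear_on_diff[OF E.graded_seminormed_space_axioms lin x X] by simp
    then have "norm (T x j) * C j k \<le> norm (T (x - X n) j) * C j k + norm (T (X n) j) * C j k"
      using mult_right_mono[OF norm_triangle_ineq koethe_matrixD(1)[OF C]] by (simp add: distrib_right)
    moreover have "norm (T (x - X n) j) * C j k \<le> D * seminorm ?E r (x - X n)"
    proof -
      have "x - X n \<in> points ?E" using x X by blast
      then have "T (x - X n) \<in> points ?F" using img by blast
      from koethe_linf_component[OF this] D[OF \<open>x - X n \<in> points ?E\<close>] show ?thesis by (rule order_trans)
    qed
    moreover have "norm (T (X n) j) * C j k \<le> M * seminorm ?E s x"
    proof -
      have "norm (T (X n) j) * C j k \<le> (\<Sum>i<n. norm (x i * T (unit_seq i) j)) * C j k"
        unfolding TX by (rule mult_right_mono[OF norm_sum koethe_matrixD(1)[OF C]])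
      also have "\<dots> = (\<Sum>i<n. norm (x i) * (norm (T (unit_seq i) j) * C j k))"
        by (simp add: sum_distrib_right norm_mult mult.assoc)
      also have "\<dots> \<le> (\<Sum>i<n. norm (x i) * (M * A i s))"
        by (intro sum_mono mult_left_mono unit) auto
      also have "\<dots> = M * (\<Sum>i<n. norm (x i) * A i s)" by (simp add: sum_distrib_left mult.left_commute)
      also have "\<dots> \<le> M * seminorm ?E s x"
        using x koethe_matrixD(1)[OF A] \<open>0 \<le> M\<close> by (auto intro!: mult_left_mono sum_le_suminf)
      finally show ?thesis .
    qed
    ultimately show ?thesis by linarith
  qed
  moreover have "(\<lambda>n. D * seminorm ?E r (x - X n) + M * seminorm ?E s x) \<longlonglongrightarrow> D * 0 + M * seminorm ?E s x"
    unfolding X_def by (intro tendsto_intros koethe_l1_truncation A x)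
  ultimately show "norm (T x j) * C j k \<le> M * seminorm ?E s x"
    using LIMSEQ_le_const by fastforce
qed

text \<open>The inequality of the theorem with \<open>k\<close> and both constants fixed, so that a
  bad \<open>k\<close> is one at which it fails for all constants.\<close>

definition rank_one_estimate ::
  "('k::real_normed_field, 'g::ab_group_add) graded_space \<Rightarrow> (nat \<Rightarrow> nat \<Rightarrow> real) \<Rightarrow> (nat \<Rightarrow> nat \<Rightarrow> real) \<Rightarrow>
   (nat \<Rightarrow> nat) \<Rightarrow> (nat \<Rightarrow> nat) \<Rightarrow> nat \<Rightarrow> nat \<Rightarrow> real \<Rightarrow> bool" where
  "rank_one_estimate G A C S \<phi> k qk Ck \<longleftrightarrow> 0 < Ck \<and>
     (\<forall>y\<in>points G. \<forall>y'\<in>dual G. \<forall>i j.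
        ennreal (C j k) / ennreal (A i (S k)) * ennreal (norm (y' y)) \<le>
        ennreal Ck *
          max_mult (MAX q\<in>{..qk}. ennreal (seminorm G q y) / ennreal (A i (\<phi> q)))
                   (MAX q\<in>{..qk}. dual_norm G (\<phi> q) y' * ennreal (C j q)))"

section \<open>From the estimates to tameness\<close>

text \<open>Choosing \<open>\<phi>\<close> above the continuity indices of both factors bounds the
  two maxima, uniformly in the matrix position, by sums of their continuity constants up to
  \<open>qk\<close>. The estimate thus bounds the matrix of \<open>T\<close>, and
  \<open>koethe_operator_bound\<close> passes to \<open>T\<close> itself.\<close>

lemma tame_if_rank_one_estimates:
  fixes G :: "('k::real_normed_field, 'g::ab_group_add) graded_space"
    and A C :: "nat \<Rightarrow> nat \<Rightarrow> real"
  assumes G: "graded_seminormed_space G" and A: "koethe_matrix A" and C: "koethe_matrix C"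
    and est: "\<And>\<phi>. mono \<phi> \<Longrightarrow> \<exists>k0. \<forall>k\<ge>k0. \<exists>qk Ck. rank_one_estimate G A C S \<phi> k qk Ck"
    and T: "T \<in> factorable_operators (koethe_l1 A) G (koethe_linf C)"
  shows "\<exists>k0. \<forall>k\<ge>k0. continuity_index (koethe_l1 A) (koethe_linf C) T k \<le> enat (S k)"
proof -
  let ?E = "koethe_l1 A :: ('k, nat \<Rightarrow> 'k) graded_space"
  let ?F = "koethe_linf C :: ('k, nat \<Rightarrow> 'k) graded_space"
  interpret E: graded_seminormed_space ?E by (rule graded_seminormed_koethe_l1[OF A])
  interpret F: graded_seminormed_space ?F by (rule graded_seminormed_koethe_linf[OF C])
  interpret G: graded_seminormed_space G by fact
  note E_ax = E.graded_seminormed_space_axioms and F_ax = F.graded_seminormed_space_axioms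
  obtain Q R where Q: "Q \<in> operators ?E G" and R: "R \<in> operators G ?F"
    and T_op: "T \<in> operators ?E ?F" and TQR: "\<And>x. x \<in> points ?E \<Longrightarrow> T x = R (Q x)"
    using T by (auto simp: factorable_operators_def)
  note Q' = Q[unfolded operators_iff[OF E_ax G]] and R' = R[unfolded operators_iff[OF G F_ax]]
  obtain f M where M: "\<And>q. 0 \<le> M q" "\<And>q x. x \<in> points ?E \<Longrightarrow> seminorm G q (Q x) \<le> M q * seminorm ?E (f q) x"
    using Q' by metis
  obtain g N where N: "\<And>q. 0 \<le> N q" "\<And>q w. w \<in> points G \<Longrightarrow> seminorm ?F q (R w) \<le> N q * seminorm G (g q) w"
    using R' by metis
  obtain \<phi> where \<phi>: "mono \<phi>" "\<And>q. f q \<le> \<phi> q" "\<And>q. g q \<le> \<phi> q"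
    using mono_common_bound by blast
  obtain k0 where k0: "\<And>k. k \<ge> k0 \<Longrightarrow> \<exists>qk Ck. rank_one_estimate G A C S \<phi> k qk Ck"
    using est[OF \<phi>(1)] by blast
  have R_comp: "norm (R w j) * C j q \<le> N q * seminorm G (g q) w" if "w \<in> points G" for w j q
    using koethe_linf_component[of "R w" C j q] N(2)[OF that, of q] R' that by (meson image_subset_iff order_trans)
  have Qe: "Q (unit_seq i) \<in> points G" for i using Q' unit_seq_koethe_l1(1)[of i A] by blast
  have Q_unit: "seminorm G q (Q (unit_seq i)) \<le> M q * A i (\<phi> q)" for q i
    using M(2)[OF unit_seq_koethe_l1(1), of q i] mult_left_mono[OF koethe_matrix_mono[OF A \<phi>(2)] M(1), of q i q]
    unfolding unit_seq_koethe_l1(2) by linarith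
  have R_lin: "linear_on (points G) (scale G) (*) (\<lambda>w. R w j)" for j
    using R' by (simp add: linear_on_def)
  have R_dual: "(\<lambda>w. R w j) \<in> dual G" for j
  proof -
    obtain q where "0 < C j q" using koethe_matrixD(3)[OF C] by blast
    then have "norm (R w j) \<le> N q / C j q * seminorm G (g q) w" if "w \<in> points G" for w
      using R_comp[OF that, of j q] by (simp add: field_simps)
    then show ?thesis using dualI[OF G R_lin] by blast
  qed
  have "continuity_index ?E ?F T k \<le> enat (S k)" if k: "k \<ge> k0" for k
  proof -
    obtain qk Ck where "rank_one_estimate G A C S \<phi> k qk Ck" using k0[OF k] by blast
    note Ck = this[unfolded rank_one_estimate_def]
    let ?P = "\<Sum>q\<le>qk. M q" and ?N = "\<Sum>q\<le>qk. N q"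
    have P: "0 \<le> ?P" and N0: "0 \<le> ?N" using M(1) N(1) by (simp_all add: sum_nonneg)
    have "norm (T (unit_seq i) j) * C j k \<le> Ck * (?P * ?N) * A i (S k)" for i j
    proof -
      let ?U = "MAX q\<in>{..qk}. ennreal (seminorm G q (Q (unit_seq i))) / ennreal (A i (\<phi> q))"
      let ?V = "MAX q\<in>{..qk}. dual_norm G (\<phi> q) (\<lambda>w. R w j) * ennreal (C j q)"
      have "ennreal (C j k) / ennreal (A i (S k)) * ennreal (norm (R (Q (unit_seq i)) j)) \<le>
          ennreal Ck * max_mult ?U ?V"
        by (rule Ck[THEN conjunct2, rule_format, OF Qe R_dual])
      also have "max_mult ?U ?V \<le> ennreal (?P * ?N)"
      proof (rule max_mult_le)
        have "ennreal (seminorm G q (Q (unit_seq i))) / ennreal (A i (\<phi> q)) \<le> ennreal ?P" if "q \<le> qk" for q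
        proof -
          have "M q \<le> ?P" using that M(1) by (intro member_le_sum) auto
          then have "seminorm G q (Q (unit_seq i)) \<le> ?P * A i (\<phi> q)"
            using Q_unit[of q i] mult_right_mono[OF _ koethe_matrixD(1)[OF A, of i "\<phi> q"]] order_trans by blast
          then show ?thesis
            using P Qe koethe_matrixD(1)[OF A] by (subst ennreal_divide_le_iff) auto
        qed
        then show "?U \<le> ennreal ?P" by (subst Max_le_iff) auto
        have "dual_norm G (\<phi> q) (\<lambda>w. R w j) * ennreal (C j q) \<le> ennreal ?N" if "q \<le> qk" for q
        proof -
          have Nq: "N q \<le> ?N" using that N(1) by (intro member_le_sum) auto
          have "norm (R w j) * C j q \<le> ?N * seminorm G (\<phi> q) w" if w: "w \<in> points G" for w
          proof -
            have "N q * seminorm G (g q) w \<le> ?N * seminorm G (\<phi> q) w"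
              using Nq N0 w G.seminorm_mono[OF w \<phi>(3)] by (intro mult_mono) auto
            then show ?thesis using R_comp[OF w, of j q] by linarith
          qed
          then show ?thesis
            using N0 koethe_matrixD(1)[OF C] by (subst dual_norm_mult_le_iff[OF G R_lin]) auto
        qed
        then show "?V \<le> ennreal ?N" by (subst Max_le_iff) auto
      qed (fact P N0)+
      finally have "ennreal (C j k) / ennreal (A i (S k)) * ennreal (norm (R (Q (unit_seq i)) j)) \<le>
          ennreal (Ck * (?P * ?N))"
        using Ck P N0 by (simp add: ennreal_mult mult_left_mono)
      then show ?thesis
        using Ck P N0 koethe_matrixD(1)[OF A] koethe_matrixD(1)[OF C] TQR[OF unit_seq_koethe_l1(1)]
        by (subst (asm) ennreal_divide_mult_le_iff) (auto simp: mult.commute)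
    qed
    moreover have "0 \<le> Ck * (?P * ?N)" using Ck P N0 by simp
    ultimately show ?thesis
      unfolding continuity_index_le_iff[OF E_ax F_ax T_op]
      using koethe_operator_bound[OF A C T_op] by blast
  qed
  then show ?thesis by blast
qed

section \<open>From tameness to the estimates\<close>

text \<open>A violating vector and functional are rescaled until both maxima up to \<open>m\<close>
  are at most \<open>e\<close>. A sufficiently large constant in the violated estimate keeps the
  pairing above \<open>B\<close>, and monotonicity of \<open>\<phi>\<close> helps to obtain finite
  bounds at all remaining indices.\<close>

lemma rank_one_estimate_violation:
  fixes G :: "('k::real_normed_field, 'g::ab_group_add) graded_space"
    and A C :: "nat \<Rightarrow> nat \<Rightarrow> real"
  assumes G: "graded_seminormed_space G" and A: "koethe_matrix A" and C: "koethe_matrix C" and \<phi>: "mono \<phi>"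
    and bad: "\<And>qk Ck. \<not> rank_one_estimate G A C S \<phi> k qk Ck"
    and e: "0 < e" and B: "0 \<le> (B::real)"
  shows "\<exists>w w' i j. w \<in> points G \<and> linear_on (points G) (scale G) (*) w' \<and>
    (\<forall>q. \<exists>M\<ge>0. seminorm G q w \<le> M * A i (\<phi> q)) \<and>
    (\<forall>q. \<exists>M\<ge>0. \<forall>x\<in>points G. norm (w' x) * C j q \<le> M * seminorm G (\<phi> q) x) \<and>
    (\<forall>q\<le>m. seminorm G q w \<le> e * A i (\<phi> q)) \<and>
    (\<forall>q\<le>m. \<forall>x\<in>points G. norm (w' x) * C j q \<le> e * seminorm G (\<phi> q) x) \<and>
    B * A i (S k) < C j k * norm (w' w)"
proof -
  interpret graded_seminormed_space G by fact
  \<comment> \<open>The range contains \<open>m\<close> for the required smallness, and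
    \<open>k\<close> and \<open>\<phi> k\<close> for positivity: the functional bound at
    \<open>k\<close> gives \<open>seminorm G (\<phi> k) y > 0\<close>, and then the vector bound at
    \<open>\<phi> k\<close> gives \<open>p > 0\<close>.\<close>
  define r where "r = m + k + \<phi> k"
  \<comment> \<open>Rescaling multiplies the violated inequality by
    \<open>e\<^sup>2 / (p * v)\<close>, so \<open>e\<^sup>2 * D\<close> must be at least
    \<open>B\<close>; the summand 1 makes \<open>D\<close> positive.\<close>
  define D where "D = B / e\<^sup>2 + 1"
  have D: "0 < D" using B by (simp add: D_def add_nonneg_pos)
  have "\<exists>y\<in>points G. \<exists>y'\<in>dual G. \<exists>i j.
      \<not> ennreal (C j k) / ennreal (A i (S k)) * ennreal (norm (y' y)) \<le>
        ennreal D *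
          max_mult (MAX q\<in>{..r}. ennreal (seminorm G q y) / ennreal (A i (\<phi> q)))
                   (MAX q\<in>{..r}. dual_norm G (\<phi> q) y' * ennreal (C j q))"
    using bad[of r D] D unfolding rank_one_estimate_def by blast
  then obtain y y' i j where y: "y \<in> points G" and y': "y' \<in> dual G" and viol:
      "\<not> ennreal (C j k) / ennreal (A i (S k)) * ennreal (norm (y' y)) \<le>
        ennreal D *
          max_mult (MAX q\<in>{..r}. ennreal (seminorm G q y) / ennreal (A i (\<phi> q)))
                   (MAX q\<in>{..r}. dual_norm G (\<phi> q) y' * ennreal (C j q))"
    by blast
  define U where "U = (MAX q\<in>{..r}. ennreal (seminorm G q y) / ennreal (A i (\<phi> q)))"
  define V where "V = (MAX q\<in>{..r}. dual_norm G (\<phi> q) y' * ennreal (C j q))"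
  note viol = viol[folded U_def V_def]
  have lin: "linear_on (points G) (scale G) (*) y'" using y' by (simp add: dual_def)
  \<comment> \<open>By the convention in \<open>max_mult\<close>, one infinite maximum would make
    the right side infinite and the violation impossible.\<close>
  have "U \<noteq> \<infinity>" "V \<noteq> \<infinity>"
    using viol D by (auto simp: max_mult_def ennreal_mult_top split: if_splits)
  then obtain p v where p: "0 \<le> p" "U = ennreal p" and v: "0 \<le> v" "V = ennreal v"
    by (cases U; cases V) auto
  have yq: "seminorm G q y \<le> p * A i (\<phi> q)" if "q \<le> r" for q
  proof -
    have "ennreal (seminorm G q y) / ennreal (A i (\<phi> q)) \<le> U" unfolding U_def using that by (intro Max_ge) auto
    then show ?thesis unfolding p(2) using y p(1) koethe_matrixD(1)[OF A]
      by (subst (asm) ennreal_divide_le_iff) auto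
  qed
  have y'q: "norm (y' x) * C j q \<le> v * seminorm G (\<phi> q) x" if "q \<le> r" "x \<in> points G" for q x
  proof -
    have "dual_norm G (\<phi> q) y' * ennreal (C j q) \<le> V" unfolding V_def using that by (intro Max_ge) auto
    then show ?thesis unfolding v(2) using that(2) v(1) koethe_matrixD(1)[OF C]
      by (subst (asm) dual_norm_mult_le_iff[OF G lin]) auto
  qed
  have "\<not> ennreal (C j k) / ennreal (A i (S k)) * ennreal (norm (y' y)) \<le> ennreal (D * (p * v))"
    using viol D p v by (simp add: max_mult_def ennreal_mult)
  then have big: "D * (p * v) * A i (S k) < C j k * norm (y' y)"
    using D p(1) v(1) koethe_matrixD(1)[OF A] koethe_matrixD(1)[OF C]
    by (subst (asm) ennreal_divide_mult_le_iff) auto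
  have pos: "0 < C j k * norm (y' y)"
    using big D p(1) v(1) koethe_matrixD(1)[OF A, of i "S k"]
    by (meson less_imp_le mult_nonneg_nonneg order_le_less_trans)
  then have Cjk: "0 < C j k" using koethe_matrixD(1)[OF C, of j k] by (cases "C j k = 0") auto
  have k_r: "k \<le> r" "\<phi> k \<le> r" "m \<le> r" by (auto simp: r_def)
  have y_ne: "0 < v * seminorm G (\<phi> k) y"
    using y'q[OF k_r(1) y] pos by (simp add: mult.commute)
  then have v_pos: "0 < v" and y_pos: "0 < seminorm G (\<phi> k) y"
    using v(1) y by (auto simp: zero_less_mult_iff)
  have p_pos: "0 < p" using yq[OF k_r(2)] y_pos p(1) by (cases "p = 0") auto
  let ?w = "scale G (of_real (e / p)) y" and ?w' = "\<lambda>x. of_real (e / v) * y' x"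
  have w: "seminorm G q ?w = e / p * seminorm G q y" for q
    using y e p_pos by (simp add: seminorm_scale norm_divide)
  have w': "norm (?w' x) * C j q = e / v * (norm (y' x) * C j q)" for x q
    using e v_pos by (simp add: norm_mult norm_divide)
  have w_le: "seminorm G q ?w \<le> e * A i (\<phi> q)" if "q \<le> r" for q
    using mult_left_mono[OF yq[OF that], of "e / p"] e p_pos unfolding w by simp
  moreover have w'_le: "norm (?w' x) * C j q \<le> e * seminorm G (\<phi> q) x" if "q \<le> r" "x \<in> points G" for q x
    using mult_left_mono[OF y'q[OF that], of "e / v"] e v_pos unfolding w' by simp
  \<comment> \<open>Beyond \<open>r\<close> the weight cannot vanish: otherwise
    \<open>A i (\<phi> r) = 0\<close> by monotonicity, so the bound at \<open>r\<close> would force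
    \<open>seminorm G r y = 0\<close>, against positivity at the smaller index
    \<open>\<phi> k\<close>.\<close>
  moreover have "\<exists>M\<ge>0. seminorm G q ?w \<le> M * A i (\<phi> q)" for q
  proof (cases "A i (\<phi> q) = 0")
    case True
    have "q \<le> r"
    proof (rule ccontr)
      assume "\<not> q \<le> r"
      then have "A i (\<phi> r) \<le> 0" using koethe_matrix_mono[OF A monoD[OF \<phi>], of r q i] True by simp
      then have "p * A i (\<phi> r) \<le> 0" using p_pos by (simp add: mult_nonneg_nonpos)
      then show False using yq[of r] seminorm_mono[OF y k_r(2)] y_pos by simp
    qed
    then show ?thesis using w_le e by (intro exI[of _ e]) auto
  next
    case False
    then have "0 < A i (\<phi> q)" using koethe_matrixD(1)[OF A, of i "\<phi> q"] by simp
    then show ?thesis using y by (intro exI[of _ "seminorm G q ?w / A i (\<phi> q)"]) auto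
  qed
  \<comment> \<open>Beyond \<open>r\<close> the bound at \<open>k\<close> is reused:
    \<open>C j k > 0\<close> allows the weight to be exchanged for \<open>C j q\<close>, and
    \<open>\<phi> k \<le> \<phi> q\<close> raises the seminorm.\<close>
  moreover have "\<exists>M\<ge>0. \<forall>x\<in>points G. norm (?w' x) * C j q \<le> M * seminorm G (\<phi> q) x" for q
  proof (cases "q \<le> r")
    case True
    then show ?thesis using w'_le e by (intro exI[of _ e]) auto
  next
    case False
    have "norm (?w' x) * C j q \<le> e * C j q / C j k * seminorm G (\<phi> q) x" if x: "x \<in> points G" for x
    proof -
      have "norm (?w' x) * C j q = norm (?w' x) * C j k * (C j q / C j k)" using Cjk by simp
      also have "\<dots> \<le> e * seminorm G (\<phi> k) x * (C j q / C j k)"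
        using w'_le[OF k_r(1) x] Cjk koethe_matrixD(1)[OF C] by (intro mult_right_mono) auto
      also have "\<dots> \<le> e * seminorm G (\<phi> q) x * (C j q / C j k)"
        using False k_r(1) e Cjk koethe_matrixD(1)[OF C]
        by (intro mult_right_mono mult_left_mono seminorm_mono[OF x] monoD[OF \<phi>]) auto
      finally show ?thesis by (simp add: mult_ac)
    qed
    then show ?thesis using e Cjk koethe_matrixD(1)[OF C]
      by (intro exI[of _ "e * C j q / C j k"]) auto
  qed
  moreover have "B * A i (S k) < C j k * norm (?w' ?w)"
  proof -
    have "B * A i (S k) \<le> e\<^sup>2 * D * A i (S k)"
      using e B koethe_matrixD(1)[OF A] by (intro mult_right_mono) (auto simp: D_def distrib_left)
    also have "\<dots> = e / p * (e / v) * (D * (p * v) * A i (S k))"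
      using p_pos v_pos by (simp add: power2_eq_square)
    also have "\<dots> < e / p * (e / v) * (C j k * norm (y' y))"
      using big e p_pos v_pos by (intro mult_strict_left_mono) auto
    also have "\<dots> = C j k * norm (?w' ?w)"
    proof -
      have "y' ?w = of_real (e / p) * y' y" using lin y unfolding linear_on_def by blast
      then show ?thesis using e p_pos v_pos by (simp add: norm_mult norm_divide mult_ac)
    qed
    finally show ?thesis .
  qed
  moreover have "linear_on (points G) (scale G) (*) ?w'"
    using lin by (simp add: linear_on_def distrib_left add_divide_distrib mult_ac)
  moreover have "?w \<in> points G" using y by simp
  moreover have "q \<le> r" if "q \<le> m" for q using that k_r(3) by simp
  ultimately show ?thesis
    by (intro exI[of _ ?w] exI[of _ ?w'] exI[of _ i] exI[of _ j]) (intro conjI allI impI ballI; simp only:)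
qed

lemma rank_one_estimates_if_tame:
  fixes G :: "('k::{real_normed_field, banach}, 'g::ab_group_add) graded_space"
    and A C :: "nat \<Rightarrow> nat \<Rightarrow> real"
  assumes G: "graded_frechet_space G" and A: "koethe_matrix A" and C: "koethe_matrix C" and \<phi>: "mono \<phi>"
    and tame: "\<And>T. T \<in> factorable_operators (koethe_l1 A :: ('k, nat \<Rightarrow> 'k) graded_space) G (koethe_linf C) \<Longrightarrow>
      \<exists>k0. \<forall>k\<ge>k0. continuity_index (koethe_l1 A) (koethe_linf C) T k \<le> enat (S k)"
  shows "\<exists>k0. \<forall>k\<ge>k0. \<exists>qk Ck. rank_one_estimate G A C S \<phi> k qk Ck"
proof (rule ccontr)
  interpret frechet_space G by standard (rule G)
  define K where "K = {k. \<forall>qk Ck. \<not> rank_one_estimate G A C S \<phi> k qk Ck}"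
  assume "\<not> ?thesis"
  then have K: "\<exists>k\<in>K. k0 \<le> k" for k0 unfolding K_def by blast
  then obtain k1 where k1: "k1 \<in> K" by blast
  txt \<open>\<open>\<kappa>\<close> takes every value in \<open>K\<close> infinitely often.\<close>
  define \<kappa> where "\<kappa> m = (if fst (prod_decode m) \<in> K then fst (prod_decode m) else k1)" for m
  have \<kappa>: "\<kappa> m \<in> K" for m using k1 by (simp add: \<kappa>_def)
  \<comment> \<open>Violation number \<open>m\<close> is taken at the bad index
    \<open>\<kappa> m\<close>, with \<open>e = (1/2)^m\<close> for summability and
    \<open>B = m\<close> for unboundedness.\<close>
  have "\<forall>m. \<exists>w w' i j. w \<in> points G \<and> linear_on (points G) (scale G) (*) w' \<and>
    (\<forall>q. \<exists>M\<ge>0. seminorm G q w \<le> M * A i (\<phi> q)) \<and>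
    (\<forall>q. \<exists>M\<ge>0. \<forall>x\<in>points G. norm (w' x) * C j q \<le> M * seminorm G (\<phi> q) x) \<and>
    (\<forall>q\<le>m. seminorm G q w \<le> (1/2)^m * A i (\<phi> q)) \<and>
    (\<forall>q\<le>m. \<forall>x\<in>points G. norm (w' x) * C j q \<le> (1/2)^m * seminorm G (\<phi> q) x) \<and>
    real m * A i (S (\<kappa> m)) < C j (\<kappa> m) * norm (w' w)"
    using \<kappa> by (intro allI rank_one_estimate_violation[OF graded_seminormed_space_axioms A C \<phi>]) (auto simp: K_def)
  then obtain y y' i j where
      y: "\<And>m. y m \<in> points G" and y': "\<And>m. linear_on (points G) (scale G) (*) (y' m)"
    and y_ex: "\<And>m q. \<exists>M\<ge>0. seminorm G q (y m) \<le> M * A (i m) (\<phi> q)"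
    and y'_ex: "\<And>m q. \<exists>M\<ge>0. \<forall>x\<in>points G. norm (y' m x) * C (j m) q \<le> M * seminorm G (\<phi> q) x"
    and y_le: "\<And>m q. q \<le> m \<Longrightarrow> seminorm G q (y m) \<le> (1/2)^m * A (i m) (\<phi> q)"
    and y'_le: "\<And>m q x. q \<le> m \<Longrightarrow> x \<in> points G \<Longrightarrow> norm (y' m x) * C (j m) q \<le> (1/2)^m * seminorm G (\<phi> q) x"
    and big: "\<And>m. real m * A (i m) (S (\<kappa> m)) < C (j m) (\<kappa> m) * norm (y' m (y m))"
    by metis
  interpret rank_one_series G A C \<phi> y i y' j
  proof
    fix q
    \<comment> \<open>The one-point index set adapts the auxiliary lemma to an estimate without a
      vector variable.\<close>
    have "\<exists>M\<ge>0. \<forall>m. \<forall>x\<in>{()}. seminorm G q (y m) \<le> M * (A (i m) (\<phi> q) * (1/2)^m)"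
    proof (rule uniform_bound_finite_exceptions)
      show "\<exists>M\<ge>0. \<forall>x\<in>{()}. seminorm G q (y m) \<le> M * (A (i m) (\<phi> q) * (1/2)^m)" for m
      proof -
        obtain M where "0 \<le> M" "seminorm G q (y m) \<le> M * A (i m) (\<phi> q)" using y_ex by blast
        then show ?thesis by (intro exI[of _ "M * 2^m"]) (simp add: power_divide)
      qed
    qed (use y_le koethe_matrixD(1)[OF A] in \<open>auto simp: mult.commute\<close>)
    then show "\<exists>M\<ge>0. \<forall>m. seminorm G q (y m) \<le> M * A (i m) (\<phi> q) * (1/2)^m" by (simp add: mult.assoc)
    have "\<exists>M\<ge>0. \<forall>m. \<forall>x\<in>points G. norm (y' m x) * C (j m) q \<le> M * (seminorm G (\<phi> q) x * (1/2)^m)"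
    proof (rule uniform_bound_finite_exceptions)
      show "\<exists>M\<ge>0. \<forall>x\<in>points G. norm (y' m x) * C (j m) q \<le> M * (seminorm G (\<phi> q) x * (1/2)^m)" for m
      proof -
        obtain M where "0 \<le> M" "\<And>x. x \<in> points G \<Longrightarrow> norm (y' m x) * C (j m) q \<le> M * seminorm G (\<phi> q) x"
          using y'_ex by blast
        then show ?thesis by (intro exI[of _ "M * 2^m"]) (simp add: power_divide)
      qed
    qed (use y'_le in \<open>auto simp: mult.commute\<close>)
    then show "\<exists>M\<ge>0. \<forall>m. \<forall>x\<in>points G. norm (y' m x) * C (j m) q \<le> M * seminorm G (\<phi> q) x * (1/2)^m"
      by (simp add: mult.assoc)
  qed (fact A C y y')+
  obtain k0 where k0: "\<And>k. k \<ge> k0 \<Longrightarrow> \<exists>M\<ge>0. \<forall>m. C (j m) k * norm (y' m (y m)) \<le> M * A (i m) (S k)"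
    using tame_imp_uniform_bound[OF tame] by blast
  obtain k where k: "k \<in> K" "k0 \<le> k" using K by blast
  obtain M where M: "\<And>m. C (j m) k * norm (y' m (y m)) \<le> M * A (i m) (S k)" using k0[OF k(2)] by blast
  obtain l where l: "M \<le> real l" using real_arch_simple by blast
  \<comment> \<open>Encoding \<open>(k, l)\<close> gives an index with \<open>\<kappa> m = k\<close>
    and \<open>m \<ge> l\<close>, so the violation at \<open>k\<close> exceeds the uniform constant
    \<open>M\<close>.\<close>
  define m where "m = prod_encode (k, l)"
  have "\<kappa> m = k" using k by (simp add: \<kappa>_def m_def)
  have "M \<le> real m" using l le_prod_encode_2[of l k] by (simp add: m_def)
  then have "M * A (i m) (S k) \<le> real m * A (i m) (S k)" by (intro mult_right_mono koethe_matrixD(1)[OF A])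
  then show False using big[of m] M[of m] \<open>\<kappa> m = k\<close> by simp
qed

theorem proposition4p5:
  fixes G :: "('k::{real_normed_field, banach}, 'g::ab_group_add) graded_space"
    and A C :: "nat \<Rightarrow> nat \<Rightarrow> real"
  assumes "graded_frechet_space G" and "koethe_matrix A" and "koethe_matrix C"
  shows "tame_factorization_property
           (koethe_l1 A :: ('k, nat \<Rightarrow> 'k) graded_space) G (koethe_linf C :: ('k, nat \<Rightarrow> 'k) graded_space) \<longleftrightarrow>
         (\<exists>S::nat \<Rightarrow> nat. mono S \<and>
            (\<forall>\<phi>::nat \<Rightarrow> nat. mono \<phi> \<longrightarrow>
               (\<exists>k0. \<forall>k\<ge>k0. \<exists>(qk::nat) (Ck::real). 0 < Ck \<and>
                  (\<forall>y\<in>points G. \<forall>y'\<in>dual G. \<forall>i j.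
                     ennreal (C j k) / ennreal (A i (S k)) * ennreal (norm (y' y)) \<le>
                     ennreal Ck *
                       max_mult (MAX q\<in>{..qk}. ennreal (seminorm G q y) / ennreal (A i (\<phi> q)))
                                (MAX q\<in>{..qk}. dual_norm G (\<phi> q) y' * ennreal (C j q))))))"
  unfolding tame_factorization_property_def rank_one_estimate_def[symmetric]
proof -
  interpret frechet_space G by standard (rule assms(1))
  \<comment> \<open>Both implications keep the same \<open>S\<close>, so the equivalence is proved
    for each fixed \<open>S\<close>.\<close>
  have "(\<forall>T\<in>factorable_operators (koethe_l1 A :: ('k, nat \<Rightarrow> 'k) graded_space) G (koethe_linf C).
        \<exists>k0. \<forall>k\<ge>k0. continuity_index (koethe_l1 A) (koethe_linf C) T k \<le> enat (S k)) \<longleftrightarrow>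
      (\<forall>\<phi>. mono \<phi> \<longrightarrow> (\<exists>k0. \<forall>k\<ge>k0. \<exists>qk Ck. rank_one_estimate G A C S \<phi> k qk Ck))" for S
    using tame_if_rank_one_estimates[OF graded_seminormed_space_axioms assms(2,3), of S]
      rank_one_estimates_if_tame[OF assms, of _ S] by blast
  then show "(\<exists>S. mono S \<and> (\<forall>T\<in>factorable_operators (koethe_l1 A :: ('k, nat \<Rightarrow> 'k) graded_space) G (koethe_linf C).
        \<exists>k0. \<forall>k\<ge>k0. continuity_index (koethe_l1 A) (koethe_linf C) T k \<le> enat (S k))) \<longleftrightarrow>
      (\<exists>S. mono S \<and> (\<forall>\<phi>. mono \<phi> \<longrightarrow> (\<exists>k0. \<forall>k\<ge>k0. \<exists>qk Ck. rank_one_estimate G A C S \<phi> k qk Ck)))"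
    by simp
qed

end
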